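(* Let $(\mathscr S,\Sigma,\mu)$ be an equicontinuous spectral measure triple with values in $\mathscr L(\mathscr F)$, where $\mathscr F$ is a separable, sequentially complete, locally sequentially weakly compact, locally convex linear topological space. Let $f:\mathscr S\to\mathbb C$ be bounded and $\Sigma$-measurable, let $E=\mu\circ f^{-1}$, and let $U=\int_{\mathscr S} f\,d\mu=\int_{\sigma(U)} z\,E(dz)$. Assume that $U$ has a minimal point spectrum, that the point spectrum of $U$ is concentrated on isolated circles, and that there is a constant $C$ with $0<C^{-1}\le\inf_{\xi\in\sigma(U)}|\xi|$. Then for every $\lambda\in\sigma_p(U)$, $$E(\{\lambda\})=\lim_{n\to\infty}A_n\big(\lambda U^{-1}(I-E(\Omega))\big)$$ in the strong operator topology, where $\Omega=\{\xi\in\sigma(U) : |\xi|<|\lambda|\}$.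
   Context: A locally convex linear topological space $\mathscr F$ is a complex vector space with the locally convex topology (the "strong topology") generated by a separating family of seminorms. $\mathscr L(\mathscr F)$ is the set of continuous linear operators on $\mathscr F$. $\mathscr F$ is locally sequentially weakly compact if every bounded sequence has a subsequence converging weakly to an element of $\mathscr F$. $T_n\to T$ in the strong operator topology means $p(T_n\psi-T\psi)\to0$ for every $\psi\in\mathscr F$ and every continuous seminorm $p$. Spectral measure triple: $\mathscr S$ is a set, $\Sigma$ a $\sigma$-algebra of subsets of $\mathscr S$, and $\mu:\Sigma\to\mathscr L(\mathscr F)$ is countably additive in the weak operator topology with $\mu(\mathscr S)=I$ and $\mu(A_1\cap A_2)=\mu(A_1)\mu(A_2)$. It is equicontinuous if for every continuous seminorm $p$ there is a continuous seminorm $p'$ with $p(\mu(A)\psi)\le p'(\psi)$ for all $A\in\Sigma$, $\psi\in\mathscr F$. Under equicontinuity and sequential completeness, $\int_{\mathscr S} g\,d\mu\in\mathscr L(\mathscr F)$ is defined for bounded $\Sigma$-measurable $g:\mathscr S\to\mathbb C$ and is multiplicative. With $E:=\mu\circ f^{-1}$ (on Borel subsets of $\mathbb C$), $U=\int_{\mathbb C} z\,E(dz)$. The resolvent set $\rho(U)$ is the set of $\xi\in\mathbb C$ such that the image of $\xi I-U$ is dense and $(\xi I-U)^{-1}$ exists and is continuous; $\sigma(U)=\mathbb C\setminus\rho(U)$; $\sigma_p(U)$ is the set of $\lambda\in\sigma(U)$ for which $\lambda I-U$ has no inverse. Dominating point spectrum: let $\sigma$ be a spectrum with subset $\sigma_p$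 of eigenvalues and $\mathbb D_r$ the open disc of radius $r$ about $0$. It is dominating if there is $R>0$ such that $\sigma\setminus\mathbb D_R\neq\emptyset$ and for every $r>R$: (i) if $\mathbb D_r\cap\sigma_p\neq\emptyset$, then the peripheral spectrum $\{\lambda\in\sigma\cap\mathbb D_r:|\lambda|=\sup_{\xi\in\sigma\cap\mathbb D_r}|\xi|\}$ is not empty; and (ii) $\sigma\setminus\mathbb D_r$ consists only of eigenvalues. Minimal point spectrum: $U$ has minimal point spectrum if $\sigma^{-1}(U):=\{\lambda^{-1}:\lambda\in\sigma(U)\}\subset\mathbb C\cup\{\infty\}$ has a dominating point spectrum (with the reciprocals of the eigenvalues of $U$ in the role of the eigenvalues). Point spectrum concentrated on isolated circles: every point of $\{r\in\mathbb R : \exists s\in\mathscr S,\ |f(s)|=r,\ (f(s)I-U)^{-1}\text{ does not exist}\}$ is an isolated point; equivalently, $\{|\lambda|:\lambda\in\sigma_p(U)\}$ is a discrete set. Averaging operators: $A_n(T):=n^{-1}\sum_{k=0}^{n-1}T^k$. *)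

theory Defs
  imports "HOL-Analysis.Analysis"
begin

section \<open>Complex locally convex spaces\<close>

class complex_vector = ab_group_add +
  fixes scaleC :: "complex \<Rightarrow> 'a \<Rightarrow> 'a"  (infixr \<open>*\<^sub>C\<close> 75)
  assumes scaleC_add_right: "a *\<^sub>C (x + y) = a *\<^sub>C x + a *\<^sub>C y"
    and scaleC_add_left: "(a + b) *\<^sub>C x = a *\<^sub>C x + b *\<^sub>C x"
    and scaleC_scaleC: "a *\<^sub>C b *\<^sub>C x = (a * b) *\<^sub>C x"
    and scaleC_one: "1 *\<^sub>C x = x"

definition (in complex_vector) seminorm :: "('a \<Rightarrow> real) \<Rightarrow> bool" where
  "seminorm p \<longleftrightarrow>
     (\<forall>x y. p (x + y) \<le> p x + p y) \<and> (\<forall>c x. p (c *\<^sub>C x) = cmod c * p x)"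

class locally_convex = complex_vector + topological_space +
  assumes open_seminorms:
    "\<exists>P. (\<forall>p\<in>P. seminorm p) \<and> (\<forall>x. x \<noteq> 0 \<longrightarrow> (\<exists>p\<in>P. p x \<noteq> 0)) \<and>
         open = generate_topology {{y. p (y - x) < e} | p x e. p \<in> P \<and> e > 0}"

definition continuous_seminorm :: "('a::locally_convex \<Rightarrow> real) \<Rightarrow> bool" where
  "continuous_seminorm p \<longleftrightarrow> seminorm p \<and> continuous_on UNIV p"

definition continuous_functional :: "('a::locally_convex \<Rightarrow> complex) \<Rightarrow> bool" where
  "continuous_functional \<phi> \<longleftrightarrow> Vector_Spaces.linear (*\<^sub>C) (*) \<phi> \<and> continuous_on UNIV \<phi>"

definition continuous_operators :: "('a::locally_convex \<Rightarrow> 'a) set" where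
  "continuous_operators = {T. Vector_Spaces.linear (*\<^sub>C) (*\<^sub>C) T \<and> continuous_on UNIV T}"

definition sot_tendsto ::
    "(nat \<Rightarrow> 'a::locally_convex \<Rightarrow> 'a) \<Rightarrow> ('a \<Rightarrow> 'a) \<Rightarrow> bool" where
  "sot_tendsto T T' \<longleftrightarrow>
     (\<forall>p \<psi>. continuous_seminorm p \<longrightarrow> (\<lambda>n. p (T n \<psi> - T' \<psi>)) \<longlonglongrightarrow> 0)"

definition sequentially_complete :: "'a::locally_convex itself \<Rightarrow> bool" where
  "sequentially_complete (_ :: 'a itself) \<longleftrightarrow>
     (\<forall>x :: nat \<Rightarrow> 'a.
        (\<forall>p. continuous_seminorm p \<longrightarrow> (\<forall>e>0. \<exists>N. \<forall>m\<ge>N. \<forall>n\<ge>N. p (x m - x n) < e))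
        \<longrightarrow> (\<exists>l. x \<longlonglongrightarrow> l))"

definition locally_seq_weakly_compact :: "'a::locally_convex itself \<Rightarrow> bool" where
  "locally_seq_weakly_compact (_ :: 'a itself) \<longleftrightarrow>
     (\<forall>x :: nat \<Rightarrow> 'a.
        (\<forall>p. continuous_seminorm p \<longrightarrow> (\<exists>B. \<forall>n. p (x n) \<le> B))
        \<longrightarrow> (\<exists>r l. strict_mono r \<and>
              (\<forall>\<phi>. continuous_functional \<phi> \<longrightarrow> (\<lambda>n. \<phi> (x (r n))) \<longlonglongrightarrow> \<phi> l)))"


section \<open>Spectral measures and integrals\<close>

text \<open>
  Here and below \<open>M\<close> stands for the measurable space \<open>(space M, sets M)\<close>; the measure
  carried by \<open>M\<close> plays no role.
\<close>

definition spectral_measure :: "'s measure \<Rightarrow> ('s set \<Rightarrow> 'a::locally_convex \<Rightarrow> 'a) \<Rightarrow> bool" where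
  "spectral_measure M \<mu> \<longleftrightarrow>
     (\<forall>A\<in>sets M. \<mu> A \<in> continuous_operators) \<and>
     (\<forall>A :: nat \<Rightarrow> 's set. range A \<subseteq> sets M \<longrightarrow> disjoint_family A \<longrightarrow>
        (\<forall>\<phi> \<psi>. continuous_functional \<phi> \<longrightarrow> (\<lambda>n. \<phi> (\<mu> (A n) \<psi>)) sums \<phi> (\<mu> (\<Union>n. A n) \<psi>))) \<and>
     \<mu> (space M) = id \<and>
     (\<forall>A\<in>sets M. \<forall>B\<in>sets M. \<mu> (A \<inter> B) = \<mu> A \<circ> \<mu> B)"

definition equicontinuous_measure ::
    "'s measure \<Rightarrow> ('s set \<Rightarrow> 'a::locally_convex \<Rightarrow> 'a) \<Rightarrow> bool" where
  "equicontinuous_measure M \<mu> \<longleftrightarrow>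
     (\<forall>p. continuous_seminorm p \<longrightarrow>
        (\<exists>p'. continuous_seminorm p' \<and> (\<forall>A\<in>sets M. \<forall>\<psi>. p (\<mu> A \<psi>) \<le> p' \<psi>)))"

definition simple_spectral_integral ::
    "'s measure \<Rightarrow> ('s set \<Rightarrow> 'a::locally_convex \<Rightarrow> 'a) \<Rightarrow> ('s \<Rightarrow> complex) \<Rightarrow> 'a \<Rightarrow> 'a" where
  "simple_spectral_integral M \<mu> s \<psi> = (\<Sum>z\<in>s ` space M. z *\<^sub>C \<mu> (s -` {z} \<inter> space M) \<psi>)"

text \<open>
  For an equicontinuous spectral measure on a sequentially complete space, every bounded
  measurable \<open>g\<close> has exactly one integral in this sense, since
  \<open>p (\<integral>s d\<mu> \<psi>)\<close> is bounded by \<open>sup |s|\<close> times a continuous seminorm of \<open>\<psi>\<close>.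
\<close>

definition has_spectral_integral ::
    "'s measure \<Rightarrow> ('s set \<Rightarrow> 'a::locally_convex \<Rightarrow> 'a) \<Rightarrow> ('s \<Rightarrow> complex) \<Rightarrow> ('a \<Rightarrow> 'a) \<Rightarrow> bool" where
  "has_spectral_integral M \<mu> g T \<longleftrightarrow>
     T \<in> continuous_operators \<and>
     (\<exists>s :: nat \<Rightarrow> 's \<Rightarrow> complex.
        (\<forall>n. simple_function M (s n)) \<and> uniform_limit (space M) s g sequentially \<and>
        sot_tendsto (\<lambda>n. simple_spectral_integral M \<mu> (s n)) T)"

definition spectral_integral ::
    "'s measure \<Rightarrow> ('s set \<Rightarrow> 'a::locally_convex \<Rightarrow> 'a) \<Rightarrow> ('s \<Rightarrow> complex) \<Rightarrow> 'a \<Rightarrow> 'a" where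
  "spectral_integral M \<mu> g = (THE T. has_spectral_integral M \<mu> g T)"

definition has_spectral_set_integral ::
    "'s measure \<Rightarrow> ('s set \<Rightarrow> 'a::locally_convex \<Rightarrow> 'a) \<Rightarrow> 's set \<Rightarrow> ('s \<Rightarrow> complex) \<Rightarrow> ('a \<Rightarrow> 'a) \<Rightarrow> bool" where
  "has_spectral_set_integral M \<mu> B g T \<longleftrightarrow>
     B \<in> sets M \<and> has_spectral_integral M \<mu> (\<lambda>x. if x \<in> B then g x else 0) T"


section \<open>Spectra\<close>

definition pencil :: "('a::locally_convex \<Rightarrow> 'a) \<Rightarrow> complex \<Rightarrow> 'a \<Rightarrow> 'a" where
  "pencil U \<xi> \<psi> = \<xi> *\<^sub>C \<psi> - U \<psi>"

text \<open>The inverse of \<open>\<xi> I - U\<close> is only required to live on the (dense) image of \<open>\<xi> I - U\<close>.\<close>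

definition resolvent_set :: "('a::locally_convex \<Rightarrow> 'a) \<Rightarrow> complex set" where
  "resolvent_set U = {\<xi>. closure (range (pencil U \<xi>)) = UNIV \<and> inj (pencil U \<xi>) \<and>
      continuous_on (range (pencil U \<xi>)) (inv (pencil U \<xi>))}"

definition spectrum :: "('a::locally_convex \<Rightarrow> 'a) \<Rightarrow> complex set" where
  "spectrum U = - resolvent_set U"

definition point_spectrum :: "('a::locally_convex \<Rightarrow> 'a) \<Rightarrow> complex set" where
  "point_spectrum U = {\<xi> \<in> spectrum U. \<not> inj (pencil U \<xi>)}"

text \<open>
  The extended plane is represented by \<^typ>\<open>complex option\<close> with \<open>None\<close> as the point at
  infinity, as in \<^const>\<open>Alexandroff_compactification\<close>.
\<close>

definition ext_cmod :: "complex option \<Rightarrow> ereal" where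
  "ext_cmod z = (case z of None \<Rightarrow> \<infinity> | Some w \<Rightarrow> ereal (cmod w))"

definition ext_inverse :: "complex \<Rightarrow> complex option" where
  "ext_inverse z = (if z = 0 then None else Some (inverse z))"

definition ext_disc :: "real \<Rightarrow> complex option set" where
  "ext_disc r = Some ` ball 0 r"

definition peripheral :: "complex option set \<Rightarrow> complex option set" where
  "peripheral \<sigma> = {z \<in> \<sigma>. ext_cmod z = (SUP w\<in>\<sigma>. ext_cmod w)}"

definition dominating_point_spectrum :: "complex option set \<Rightarrow> complex option set \<Rightarrow> bool" where
  "dominating_point_spectrum \<sigma> \<sigma>p \<longleftrightarrow>
     (\<exists>R>0. \<sigma> - ext_disc R \<noteq> {} \<and>
       (\<forall>r>R. (ext_disc r \<inter> \<sigma>p \<noteq> {} \<longrightarrow> peripheral (\<sigma> \<inter> ext_disc r) \<noteq> {}) \<and>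
              \<sigma> - ext_disc r \<subseteq> \<sigma>p))"

definition minimal_point_spectrum :: "('a::locally_convex \<Rightarrow> 'a) \<Rightarrow> bool" where
  "minimal_point_spectrum U \<longleftrightarrow>
     dominating_point_spectrum (ext_inverse ` spectrum U) (ext_inverse ` point_spectrum U)"

definition concentrated_on_isolated_circles ::
    "'s measure \<Rightarrow> ('s \<Rightarrow> complex) \<Rightarrow> ('a::locally_convex \<Rightarrow> 'a) \<Rightarrow> bool" where
  "concentrated_on_isolated_circles M f U \<longleftrightarrow>
     discrete {r :: real. \<exists>s\<in>space M. cmod (f s) = r \<and> \<not> inj (pencil U (f s))}"

definition averaging :: "nat \<Rightarrow> ('a::locally_convex \<Rightarrow> 'a) \<Rightarrow> 'a \<Rightarrow> 'a" where
  "averaging n T \<psi> = inverse (of_nat n) *\<^sub>C (\<Sum>k<n. (T ^^ k) \<psi>)"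

end

theory Submission
  imports Defs
begin

text \<open>
  Writing \<open>\<Phi>\<close> for the bounded functional calculus of \<open>\<mu>\<close>, the hypotheses on the spectrum make
  \<open>U\<close> injective and \<open>E\<close> supported where \<open>|z| \<ge> 1 / C\<close>, so that \<open>\<lambda> U\<inverse> (I - E \<Omega>) = \<Phi> h\<close> for a
  function \<open>h\<close> with \<open>|h| \<le> 1\<close> that equals \<open>1\<close> exactly where \<open>f = \<lambda>\<close>. The powers of \<open>T = \<Phi> h\<close> are
  equicontinuous. On the range of \<open>\<mu> {|1 - h| \<ge> 1 / k}\<close> every vector has the form \<open>x - T x\<close>,
  hence its averages tend to \<open>0\<close>. These ranges exhaust that of \<open>\<mu> {h \<noteq> 1}\<close> strongly, because weak
  countable additivity and equicontinuity together imply strong continuity along increasing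
  sequences; this last step rests on the Hahn--Banach theorem.
\<close>

section \<open>Seminorms and the Hahn--Banach theorem\<close>

text \<open>Equicontinuity bounds \<open>p (\<mu> A x)\<close> by another seminorm of
  \<open>x\<close>, uniformly in \<open>A\<close> but for one set at a time. Estimating the integral
  of a simple function by the triangle inequality would therefore cost a factor equal to the number
  of its values. A convexity argument removes that factor and leaves the constant 4, one unit for
  each positive and negative part of Re and Im. This single bound yields existence, uniqueness and
  multiplicativity of the calculus. Each application of an operator may also change the seminorm, so
  the powers of \<open>T\<close> cannot be controlled by iterating an estimate for \<open>T\<close>.
  Instead \<open>T ^^ k\<close> is the integral of \<open>h ^ k\<close>, and since
  \<open>|h ^ k| \<le> 1\<close> the one bound covers all \<open>k\<close>. The bound by
  \<open>inverse C\<close> puts 0 in the resolvent set, hence \<open>U\<close> is injective.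
  Integrating \<open>f\<close> everywhere or only where it meets the spectrum gives the same
  \<open>U\<close>, so \<open>U\<close> annihilates the range of \<open>E\<close> off the spectrum,
  and by injectivity that range is 0.\<close>

interpretation scaleC: vector_space "(*\<^sub>C) :: complex \<Rightarrow> 'a::complex_vector \<Rightarrow> 'a"
  by unfold_locales (simp_all add: scaleC_add_right scaleC_add_left scaleC_scaleC scaleC_one)

lemma linear_scaleC_iff:
  "Vector_Spaces.linear (*\<^sub>C) (*\<^sub>C) T \<longleftrightarrow>
     (\<forall>x y. T (x + y) = T x + T y) \<and> (\<forall>c x. T (c *\<^sub>C x) = c *\<^sub>C T x)"
  for T :: "'a::complex_vector \<Rightarrow> 'b::complex_vector"
  using scaleC.vector_space_axioms[where ?'a='a] scaleC.vector_space_axioms[where ?'a='b]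
  by (auto simp: Vector_Spaces.linear_iff)

lemma linear_functional_iff:
  "Vector_Spaces.linear (*\<^sub>C) (*) \<phi> \<longleftrightarrow>
     (\<forall>x y. \<phi> (x + y) = \<phi> x + \<phi> y) \<and> (\<forall>c x. \<phi> (c *\<^sub>C x) = c * \<phi> x)"
  for \<phi> :: "'a::complex_vector \<Rightarrow> complex"
  using scaleC.vector_space_axioms[where ?'a='a] vector_space_over_itself.vector_space_axioms[where ?'a=complex]
  by (auto simp: Vector_Spaces.linear_iff)

lemma seminormD:
  assumes "seminorm p"
  shows seminorm_triangle: "p (x + y) \<le> p x + p y"
    and seminorm_scaleC: "p (c *\<^sub>C x) = cmod c * p x"
    and seminorm_zero: "p 0 = 0"
    and seminorm_minus: "p (- x) = p x"
    and seminorm_nonneg: "0 \<le> p x"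
    and seminorm_triangle_diff: "p (x - y) \<le> p x + p y"
    and seminorm_minus_commute: "p (x - y) = p (y - x)"
proof -
  show tri: "p (x + y) \<le> p x + p y" for x y
    using assms by (simp add: seminorm_def)
  show hom: "p (c *\<^sub>C x) = cmod c * p x" for c x
    using assms by (simp add: seminorm_def)
  show zero: "p 0 = 0"
    using hom[of 0 0] by simp
  show minus: "p (- x) = p x" for x
    using hom[of "-1" x] by (simp add: scaleC_one)
  show "0 \<le> p x"
    using tri[of x "- x"] zero minus[of x] by simp
  show "p (x - y) \<le> p x + p y"
    using tri[of x "- y"] minus[of y] by simp
  show "p (x - y) = p (y - x)"
    using minus[of "x - y"] by simp
qed

lemma seminorm_diff_abs:
  assumes "seminorm p"
  shows "\<bar>p x - p y\<bar> \<le> p (x - y)"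
  using seminorm_triangle[OF assms, of "x - y" y] seminorm_triangle[OF assms, of "y - x" x]
    seminorm_minus_commute[OF assms, of x y] by auto

lemma seminorm_sum:
  assumes "seminorm p"
  shows "p (sum g I) \<le> (\<Sum>i\<in>I. p (g i))"
proof (induction I rule: infinite_finite_induct)
  case (insert i I)
  then show ?case
    using seminorm_triangle[OF assms, of "g i" "sum g I"] by simp
qed (simp_all add: seminorm_zero[OF assms])

text \<open>Homogeneity is asked only for positive real scalars, embedded in the complex ones: the
  extension argument runs over the reals. Unlike a seminorm, \<open>g\<close> may take negative
  values, which allows minimal elements to be real-linear.\<close>

definition sublinear :: "('a::complex_vector \<Rightarrow> real) \<Rightarrow> bool" where
  "sublinear g \<longleftrightarrow> (\<forall>x y. g (x + y) \<le> g x + g y) \<and>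
     (\<forall>r>0. \<forall>x. g (complex_of_real r *\<^sub>C x) = r * g x) \<and> g 0 = 0"

lemma seminorm_imp_sublinear: "seminorm p \<Longrightarrow> sublinear p"
  by (simp add: sublinear_def seminormD)

lemma sublinear_scale_nonneg:
  assumes "sublinear g" "0 \<le> r"
  shows "g (complex_of_real r *\<^sub>C x) = r * g x"
  using assms by (cases "r = 0") (auto simp: sublinear_def)

lemma sublinear_minus_le: "sublinear g \<Longrightarrow> - g (- x) \<le> g x"
proof -
  assume g: "sublinear g"
  then have "g (x + - x) \<le> g x + g (- x)" "g 0 = 0"
    unfolding sublinear_def by blast+
  then show ?thesis by simp
qed

text \<open>Forcing \<open>g\<close> to become linear in the direction \<open>x\<close>; minimal sublinear functionals are
  fixed by this for every \<open>x\<close>.\<close>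

definition linearize_along :: "('a::complex_vector \<Rightarrow> real) \<Rightarrow> 'a \<Rightarrow> 'a \<Rightarrow> real" where
  "linearize_along g x y = (INF t\<in>{0..}. g (y + complex_of_real t *\<^sub>C x) - t * g x)"

text \<open>The parameters \<open>t = 0\<close> and \<open>t = 1\<close> give the first two claims.
  Sublinearity is reparametrisation: parameters \<open>t\<close> and \<open>s\<close> of two
  summands merge into \<open>t + s\<close>, and a factor \<open>r\<close> turns \<open>t\<close>
  into \<open>r * t\<close>.\<close>

lemma linearize_along:
  fixes g :: "'a::complex_vector \<Rightarrow> real"
  assumes g: "sublinear g"
  shows linearize_along_le_self: "linearize_along g x y \<le> g y"
    and linearize_along_minus: "linearize_along g x (- x) \<le> - g x"
    and sublinear_linearize_along: "sublinear (linearize_along g x)"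
proof -
  have tri: "g (x + y) \<le> g x + g y" for x y
    using g by (simp add: sublinear_def)
  have g0: "g 0 = 0"
    using g by (simp add: sublinear_def)
  \<comment> \<open>A lower bound independent of \<open>t\<close> is what makes the real infimum
    meaningful; it is subadditivity at \<open>y + t x\<close> and \<open>- y\<close>.\<close>
  have "- g (- y) \<le> g (y + complex_of_real t *\<^sub>C x) - t * g x" if "0 \<le> t" for t y
    using tri[of "y + complex_of_real t *\<^sub>C x" "- y"] sublinear_scale_nonneg[OF g that, of x] by simp
  then have bdd: "bdd_below ((\<lambda>t. g (y + complex_of_real t *\<^sub>C x) - t * g x) ` {0..})" for y
    by (intro bdd_belowI2[where m = "- g (- y)"]) simp
  have le: "linearize_along g x y \<le> g (y + complex_of_real t *\<^sub>C x) - t * g x" if "0 \<le> t" for t y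
    unfolding linearize_along_def using that by (intro cINF_lower bdd) simp
  show self: "linearize_along g x y \<le> g y" for y
    using le[of 0 y] by simp
  show "linearize_along g x (- x) \<le> - g x"
    using le[of 1 "- x"] by (simp add: scaleC_one g0)
  have greatest: "c \<le> linearize_along g x y"
    if "\<And>t. 0 \<le> t \<Longrightarrow> c \<le> g (y + complex_of_real t *\<^sub>C x) - t * g x" for c y
    unfolding linearize_along_def using that by (intro cINF_greatest) auto
  have add: "linearize_along g x (y + z) \<le> linearize_along g x y + linearize_along g x z" for y z
  proof -
    have 1: "linearize_along g x (y + z) \<le>
        (g (y + complex_of_real t *\<^sub>C x) - t * g x) + (g (z + complex_of_real s *\<^sub>C x) - s * g x)"
      if "0 \<le> t" "0 \<le> s" for t s
      using le[of "t + s" "y + z"] that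
        tri[of "y + complex_of_real t *\<^sub>C x" "z + complex_of_real s *\<^sub>C x"]
      by (simp add: scaleC_add_left algebra_simps)
    have "linearize_along g x (y + z) - (g (y + complex_of_real t *\<^sub>C x) - t * g x) \<le> linearize_along g x z"
      if "0 \<le> t" for t
      by (rule greatest) (use 1[OF that] in \<open>simp add: algebra_simps\<close>)
    then have "linearize_along g x (y + z) - linearize_along g x z \<le> linearize_along g x y"
      by (intro greatest) (simp add: algebra_simps)
    then show ?thesis by simp
  qed
  have scale_le: "linearize_along g x (complex_of_real r *\<^sub>C y) \<le> r * linearize_along g x y" if "0 < r" for r y
  proof -
    have "linearize_along g x (complex_of_real r *\<^sub>C y) / r \<le> g (y + complex_of_real t *\<^sub>C x) - t * g x"
      if "0 \<le> t" for t
    proof -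
      have "linearize_along g x (complex_of_real r *\<^sub>C y)
          \<le> g (complex_of_real r *\<^sub>C (y + complex_of_real t *\<^sub>C x)) - r * t * g x"
        using le[of "r * t" "complex_of_real r *\<^sub>C y"] \<open>0 < r\<close> that
        by (simp add: scaleC_add_right)
      also have "\<dots> = r * (g (y + complex_of_real t *\<^sub>C x) - t * g x)"
        using sublinear_scale_nonneg[OF g, of r "y + complex_of_real t *\<^sub>C x"] \<open>0 < r\<close>
        by (simp add: right_diff_distrib)
      finally show ?thesis
        using \<open>0 < r\<close> by (simp add: field_simps)
    qed
    then have "linearize_along g x (complex_of_real r *\<^sub>C y) / r \<le> linearize_along g x y"
      by (rule greatest)
    then show ?thesis
      using that by (simp add: field_simps)
  qed
  have "linearize_along g x (complex_of_real r *\<^sub>C y) = r * linearize_along g x y" if "0 < r" for r y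
  proof (rule antisym)
    have "linearize_along g x y \<le> inverse r * linearize_along g x (complex_of_real r *\<^sub>C y)"
      using scale_le[of "inverse r" "complex_of_real r *\<^sub>C y"] that
      by (simp add: scaleC_one flip: of_real_mult)
    then show "r * linearize_along g x y \<le> linearize_along g x (complex_of_real r *\<^sub>C y)"
      using that by (simp add: field_simps)
  qed (rule scale_le[OF that])
  moreover have "linearize_along g x 0 = 0"
  proof (rule antisym)
    show "linearize_along g x 0 \<le> 0" using self[of 0] g0 by simp
    show "0 \<le> linearize_along g x 0"
      by (rule greatest) (simp add: sublinear_scale_nonneg[OF g])
  qed
  ultimately show "sublinear (linearize_along g x)"
    using add by (simp add: sublinear_def)
qed

text \<open>Zorn's lemma: the pointwise infimum of a nonempty chain is finite because every member
  stays above \<open>- g (- x)\<close>, and it is again sublinear.\<close>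

lemma minimal_sublinear_exists:
  fixes g :: "'a::complex_vector \<Rightarrow> real"
  assumes g: "sublinear g"
  obtains m where "sublinear m" "m \<le> g" "\<And>h. sublinear h \<Longrightarrow> h \<le> m \<Longrightarrow> h = m"
proof -
  define A where "A = {h. sublinear h \<and> h \<le> g}"
  \<comment> \<open>The order is reversed because Zorn's lemma delivers maximal elements.\<close>
  define P where "P = (\<lambda>h k :: 'a \<Rightarrow> real. k \<le> h)"
  have po: "partial_order_on A (relation_of P A)"
    by (rule partial_order_on_relation_ofI) (auto simp: P_def)
  have "\<exists>u\<in>A. \<forall>h\<in>C. P h u" if C: "C \<in> Chains (relation_of P A)" for C
  proof (cases "C = {}")
    case True
    then show ?thesis using g by (auto simp: A_def)
  next
    case False
    have sub: "sublinear h" "h \<le> g" if "h \<in> C" for h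
      using C that by (auto simp: Chains_def relation_of_def A_def)
    have chain: "h \<le> k \<or> k \<le> h" if "h \<in> C" "k \<in> C" for h k
      using C that by (auto simp: Chains_def relation_of_def P_def)
    define u where "u x = (INF h\<in>C. h x)" for x
    have "- g (- x) \<le> h x" if "h \<in> C" for h x
      using sublinear_minus_le[OF sub(1)[OF that], of x] le_funD[OF sub(2)[OF that], of "- x"] by simp
    then have bdd: "bdd_below ((\<lambda>h. h x) ` C)" for x
      by (intro bdd_belowI2)
    have le: "u x \<le> h x" if "h \<in> C" for h x
      unfolding u_def using that by (intro cINF_lower bdd)
    have greatest: "c \<le> u x" if "\<And>h. h \<in> C \<Longrightarrow> c \<le> h x" for c x
      unfolding u_def using that False by (intro cINF_greatest)
    have add: "u (x + y) \<le> u x + u y" for x y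
    proof -
      \<comment> \<open>The infima at \<open>x\<close> and \<open>y\<close> may be approached along
        different members \<open>h\<close> and \<open>k\<close>; since they are comparable, the
        smaller one serves both.\<close>
      have 1: "u (x + y) \<le> h x + k y" if hk: "h \<in> C" "k \<in> C" for h k
      proof -
        obtain l where l: "l \<in> C" "l \<le> h" "l \<le> k"
          using chain[OF hk] hk by blast
        have "u (x + y) \<le> l x + l y"
          using le[OF l(1), of "x + y"] sub(1)[OF l(1)] by (force simp: sublinear_def intro: order_trans)
        also have "\<dots> \<le> h x + k y"
          using l by (intro add_mono) (auto simp: le_fun_def)
        finally show ?thesis .
      qed
      have "u (x + y) - h x \<le> u y" if "h \<in> C" for h
        by (rule greatest) (use 1[OF that] in \<open>simp add: algebra_simps\<close>)
      then have "u (x + y) - u y \<le> u x"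
        by (intro greatest) (simp add: algebra_simps)
      then show ?thesis by simp
    qed
    have scale: "u (complex_of_real r *\<^sub>C x) = r * u x" if r: "0 < r" for r x
    proof (rule antisym)
      have eq: "h (complex_of_real r *\<^sub>C x) = r * h x" if "h \<in> C" for h
        using sub(1)[OF that] r by (simp add: sublinear_def)
      have "u (complex_of_real r *\<^sub>C x) / r \<le> u x"
        by (rule greatest) (use le[of _ "complex_of_real r *\<^sub>C x"] eq r in \<open>force simp: field_simps\<close>)
      then show "u (complex_of_real r *\<^sub>C x) \<le> r * u x"
        using r by (simp add: field_simps)
      show "r * u x \<le> u (complex_of_real r *\<^sub>C x)"
        by (rule greatest) (use le[of _ x] eq r in \<open>force simp: field_simps\<close>)
    qed
    have zero: "h 0 = 0" if "h \<in> C" for h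
      using sub(1)[OF that] by (simp add: sublinear_def)
    have "u 0 = 0"
    proof (rule antisym)
      obtain h where "h \<in> C" using False by blast
      then show "u 0 \<le> 0" using le[of h 0] zero[of h] by simp
    qed (rule greatest, simp add: zero)
    then have "sublinear u"
      using add scale by (simp add: sublinear_def)
    moreover have "u \<le> g"
    proof (rule le_funI)
      fix x
      obtain h where "h \<in> C" using False by blast
      then show "u x \<le> g x"
        using le[of h x] le_funD[OF sub(2), of h x] by simp
    qed
    ultimately show ?thesis
      using le by (auto simp: A_def P_def le_fun_def)
  qed
  from predicate_Zorn[OF po this] obtain m where
    m: "m \<in> A" "\<And>h. h \<in> A \<Longrightarrow> P m h \<Longrightarrow> h = m"
    by blast
  show ?thesis
    by (rule that[of m]) (use m in \<open>auto simp: A_def P_def\<close>)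
qed

text \<open>A minimal sublinear functional is odd, and an odd sublinear functional is real-linear.
  The complex functional is the one with this real part, and rotating \<open>y\<close> by a phase
  transfers the bound from the real part to the modulus.\<close>

theorem hahn_banach:
  fixes q :: "'a::complex_vector \<Rightarrow> real"
  assumes q: "seminorm q"
  obtains \<phi> where "Vector_Spaces.linear (*\<^sub>C) (*) \<phi>" "\<And>y. cmod (\<phi> y) \<le> q y" "\<phi> x = q x"
proof -
  note sq = seminorm_imp_sublinear[OF q]
  \<comment> \<open>Minimising below \<open>linearize_along q x\<close> instead of \<open>q\<close>
    forces \<open>m (- x) \<le> - q x\<close>, which fixes the value at \<open>x\<close>.\<close>
  obtain m where m: "sublinear m" "m \<le> linearize_along q x"
    and min: "\<And>h. sublinear h \<Longrightarrow> h \<le> m \<Longrightarrow> h = m"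
    using minimal_sublinear_exists[OF sublinear_linearize_along[OF sq, of x]] by blast
  have mq: "m y \<le> q y" for y
    using le_funD[OF m(2), of y] linearize_along_le_self[OF sq, of x y] by simp
  have fixed: "linearize_along m z = m" for z
    using m(1) by (intro min sublinear_linearize_along) (auto simp: le_fun_def linearize_along_le_self)
  have minus: "m (- z) = - m z" for z
    using linearize_along_minus[OF m(1), of z] sublinear_minus_le[OF m(1), of z] by (simp add: fixed)
  have tri: "m (y + z) \<le> m y + m z" for y z
    using m(1) by (simp add: sublinear_def)
  have add: "m (y + z) = m y + m z" for y z
    using tri[of y z] tri[of "- y" "- z"] minus[of "y + z"] by (simp add: minus)
  have scale: "m (complex_of_real r *\<^sub>C z) = r * m z" for r z
    using sublinear_scale_nonneg[OF m(1), of r z] sublinear_scale_nonneg[OF m(1), of "- r" z]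
      minus[of "complex_of_real r *\<^sub>C z"] by (cases "0 \<le> r") simp_all
  have mx: "q x \<le> m x"
    using le_funD[OF m(2), of "- x"] linearize_along_minus[OF sq, of x] by (simp add: minus)
  define \<phi> where "\<phi> y = Complex (m y) (- m (\<i> *\<^sub>C y))" for y
  have scaleC: "\<phi> (c *\<^sub>C y) = c * \<phi> y" for c y
  proof -
    have "c *\<^sub>C y = complex_of_real (Re c) *\<^sub>C y + complex_of_real (Im c) *\<^sub>C \<i> *\<^sub>C y"
    proof -
      have "c = complex_of_real (Re c) + complex_of_real (Im c) * \<i>"
        by (simp add: complex_eq_iff)
      then have "c *\<^sub>C y = (complex_of_real (Re c) + complex_of_real (Im c) * \<i>) *\<^sub>C y"
        by simp
      then show ?thesis by (simp only: scaleC_scaleC scaleC_add_left)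
    qed
    moreover have "\<i> *\<^sub>C c *\<^sub>C y = complex_of_real (Re c) *\<^sub>C \<i> *\<^sub>C y + complex_of_real (- Im c) *\<^sub>C y"
    proof -
      have "\<i> * c = complex_of_real (Re c) * \<i> + complex_of_real (- Im c)"
        by (simp add: complex_eq_iff)
      then show ?thesis by (simp only: scaleC_scaleC scaleC_add_left)
    qed
    ultimately show ?thesis
      by (simp only: \<phi>_def add scale) (simp add: complex_eq_iff)
  qed
  have "Vector_Spaces.linear (*\<^sub>C) (*) \<phi>"
    by (simp add: linear_functional_iff scaleC) (simp add: \<phi>_def add scaleC_add_right complex_eq_iff)
  moreover have bound: "cmod (\<phi> y) \<le> q y" for y
  proof (cases "\<phi> y = 0")
    case True
    then show ?thesis using seminorm_nonneg[OF q] by simp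
  next
    case False
    define c where "c = cnj (\<phi> y) / cmod (\<phi> y)"
    have "cmod c = 1" using False by (simp add: c_def norm_divide)
    have "\<phi> (c *\<^sub>C y) = cmod (\<phi> y)"
      using False by (simp add: scaleC c_def complex_norm_square[symmetric] power2_eq_square mult.commute)
    then have "cmod (\<phi> y) = m (c *\<^sub>C y)"
      by (simp add: \<phi>_def complex_eq_iff)
    also have "\<dots> \<le> q y"
      using mq[of "c *\<^sub>C y"] \<open>cmod c = 1\<close> seminorm_scaleC[OF q, of c y] by simp
    finally show ?thesis .
  qed
  \<comment> \<open>The real part already exhausts the bound \<open>q x\<close> on the modulus, so
    the imaginary part must vanish.\<close>
  moreover have "\<phi> x = q x"
  proof -
    have Re: "Re (\<phi> x) = q x" using mx mq[of x] by (simp add: \<phi>_def)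
    have "(Im (\<phi> x))\<^sup>2 \<le> 0"
      using power_mono[OF bound[of x] norm_ge_zero, of 2] by (simp add: cmod_power2 Re)
    then show ?thesis using Re by (simp add: complex_eq_iff)
  qed
  ultimately show ?thesis using that by blast
qed

text \<open>This is the quotient seminorm modulo \<open>N\<close>, pulled back to the whole space.
  It is at most \<open>p\<close> and vanishes on \<open>N\<close>, so the Hahn-Banach theorem
  applied to it produces functionals that annihilate \<open>N\<close>.\<close>

lemma seminorm_quotient:
  fixes p :: "'a::complex_vector \<Rightarrow> real"
  assumes p: "seminorm p"
    and "scaleC.subspace N"
  shows "seminorm (\<lambda>y. INF x\<in>N. p (y - x))"
    and "x \<in> N \<Longrightarrow> (INF z\<in>N. p (y - z)) \<le> p (y - x)"
proof -
  note N = scaleC.subspace_0[OF assms(2)] scaleC.subspace_add[OF assms(2)]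
    scaleC.subspace_scale[OF assms(2)]
  define q where "q = (\<lambda>y. INF x\<in>N. p (y - x))"
  have le: "q y \<le> p (y - x)" if "x \<in> N" for x y
    unfolding q_def using that
    by (intro cINF_lower bdd_belowI2[where m = 0]) (simp_all add: seminorm_nonneg[OF p])
  then show "x \<in> N \<Longrightarrow> (INF z\<in>N. p (y - z)) \<le> p (y - x)" by (simp add: q_def)
  have greatest: "c \<le> q y" if "\<And>x. x \<in> N \<Longrightarrow> c \<le> p (y - x)" for c y
    unfolding q_def using that N(1) by (intro cINF_greatest) auto
  have tri: "q (y + z) \<le> q y + q z" for y z
  proof -
    have 1: "q (y + z) \<le> p (y - x) + p (z - w)" if "x \<in> N" "w \<in> N" for x w
      using le[OF N(2)[OF that], of "y + z"] seminorm_triangle[OF p, of "y - x" "z - w"]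
      by (simp add: algebra_simps)
    have "q (y + z) - p (y - x) \<le> q z" if "x \<in> N" for x
      by (rule greatest) (use 1[OF that] in \<open>simp add: algebra_simps\<close>)
    then have "q (y + z) - q z \<le> q y"
      by (intro greatest) (simp add: algebra_simps)
    then show ?thesis by simp
  qed
  have q0: "q 0 = 0"
    using le[OF N(1), of 0] greatest[of 0 0] by (simp add: seminormD[OF p])
  have scale_le: "q (c *\<^sub>C y) \<le> cmod c * q y" for c y
  proof (cases "c = 0")
    case True
    then show ?thesis by (simp add: q0)
  next
    case False
    have "q (c *\<^sub>C y) / cmod c \<le> q y"
    proof (rule greatest)
      fix x assume "x \<in> N"
      have "q (c *\<^sub>C y) \<le> p (c *\<^sub>C (y - x))"
        using le[OF N(3)[OF \<open>x \<in> N\<close>, of c], of "c *\<^sub>C y"] by (simp add: scaleC.scale_right_diff_distrib)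
      then show "q (c *\<^sub>C y) / cmod c \<le> p (y - x)"
        using False seminorm_scaleC[OF p, of c "y - x"] by (simp add: field_simps)
    qed
    then show ?thesis using False by (simp add: field_simps)
  qed
  have "q (c *\<^sub>C y) = cmod c * q y" for c y
  proof (cases "c = 0")
    case False
    have "q y \<le> inverse (cmod c) * q (c *\<^sub>C y)"
      using scale_le[of "inverse c" "c *\<^sub>C y"] False by (simp add: scaleC_one norm_inverse)
    then have "cmod c * q y \<le> q (c *\<^sub>C y)"
      using False by (simp add: field_simps)
    then show ?thesis using scale_le[of c y] by simp
  qed (simp add: q0)
  then show "seminorm (\<lambda>y. INF x\<in>N. p (y - x))"
    using tri by (simp add: seminorm_def flip: q_def)
qed

section \<open>Continuity in locally convex spaces\<close>

lemma generating_seminorms: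
  obtains P :: "('a::locally_convex \<Rightarrow> real) set"
  where "\<And>p. p \<in> P \<Longrightarrow> seminorm p" "\<And>x. x \<noteq> 0 \<Longrightarrow> \<exists>p\<in>P. p x \<noteq> 0"
    "open = generate_topology {{y. p (y - x) < e} | p x e. p \<in> P \<and> e > 0}"
proof -
  from open_seminorms[where 'a='a] obtain P :: "('a \<Rightarrow> real) set" where
    "(\<forall>p\<in>P. seminorm p) \<and> (\<forall>x. x \<noteq> 0 \<longrightarrow> (\<exists>p\<in>P. p x \<noteq> 0)) \<and>
         open = generate_topology {{y. p (y - x) < e} | p x e. p \<in> P \<and> e > 0}"
    by (rule exE)
  then show ?thesis
    by (intro that[of P]) simp_all
qed

text \<open>Openness of the balls is assumed instead of continuity of \<open>p\<close>, so that the
  lemma can also establish continuity of the generating seminorms, whose balls are open by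
  construction.\<close>

lemma continuous_on_dist_le_seminorm:
  fixes g :: "'a::locally_convex \<Rightarrow> 'b::metric_space"
  assumes "p 0 = 0" "\<And>x e. 0 < e \<Longrightarrow> open {y. p (y - x) < e}" "\<And>x y. dist (g y) (g x) \<le> p (y - x)"
  shows "continuous_on UNIV g"
proof -
  have "(g \<longlongrightarrow> g x) (at x)" for x
  proof (rule tendstoI)
    fix e :: real assume "0 < e"
    show "\<forall>\<^sub>F y in at x. dist (g y) (g x) < e"
      unfolding eventually_at_topological
    proof (intro exI conjI)
      show "open {y. p (y - x) < e}" by (rule assms(2)[OF \<open>0 < e\<close>])
      show "x \<in> {y. p (y - x) < e}" using \<open>0 < e\<close> assms(1) by simp
      show "\<forall>y\<in>{y. p (y - x) < e}. y \<noteq> x \<longrightarrow> y \<in> UNIV \<longrightarrow> dist (g y) (g x) < e"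
        using assms(3) by (auto intro: le_less_trans)
    qed
  qed
  then show ?thesis
    by (simp add: continuous_on_def)
qed

text \<open>The class postulates no continuity of the vector operations. Translations are continuous
  because they carry subbasic balls to subbasic balls with a shifted centre.\<close>

lemma continuous_on_translation: "continuous_on UNIV (\<lambda>y::'a::locally_convex. y - a)"
proof -
  obtain P :: "('a \<Rightarrow> real) set" where
    op: "open = generate_topology {{y. p (y - x) < e} | p x e. p \<in> P \<and> e > 0}"
    by (rule generating_seminorms)
  show ?thesis
  proof (rule continuous_on_generate_topology[OF op])
    fix B assume "B \<in> {{y. p (y - x) < e} | p x e. p \<in> P \<and> e > 0}"
    then obtain p x e where B: "B = {y. p (y - x) < e}" and "p \<in> P" "e > 0" by blast
    then have "open {y. p (y - (x + a)) < e}"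
      unfolding op by (intro generate_topology.Basis) blast
    then show "\<exists>C. open C \<and> C \<inter> UNIV = (\<lambda>y. y - a) -` B \<inter> UNIV"
      by (intro exI[of _ "{y. p (y - (x + a)) < e}"]) (auto simp: B algebra_simps)
  qed
qed

lemma continuous_seminormD:
  assumes "continuous_seminorm p"
  shows "seminorm p" "continuous_on UNIV p"
  using assms by (simp_all add: continuous_seminorm_def)

lemma open_seminorm_ball:
  assumes "continuous_seminorm p"
  shows "open {y. p (y - x) < e}"
proof -
  have "continuous_on UNIV (\<lambda>y. p (y - x))"
    using continuous_on_compose2[OF continuous_seminormD(2)[OF assms] continuous_on_translation]
    by simp
  then have "open ((\<lambda>y. p (y - x)) -` {..<e})"
    by (simp add: continuous_on_open_vimage)
  then show ?thesis by (simp add: vimage_def)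
qed

lemma continuous_on_dist_le:
  fixes g :: "'a::locally_convex \<Rightarrow> 'b::metric_space"
  assumes "continuous_seminorm p" "\<And>x y. dist (g y) (g x) \<le> p (y - x)"
  shows "continuous_on UNIV g"
  using assms
  by (intro continuous_on_dist_le_seminorm[where p = p] open_seminorm_ball seminorm_zero continuous_seminormD)

lemma continuous_functional_le:
  assumes "Vector_Spaces.linear (*\<^sub>C) (*) \<phi>" "continuous_seminorm p" "\<And>x. cmod (\<phi> x) \<le> p x"
  shows "continuous_functional \<phi>"
  unfolding continuous_functional_def
proof (intro conjI assms(1) continuous_on_dist_le[OF assms(2)])
  fix x y
  have "\<phi> y = \<phi> (y - x) + \<phi> x"
    using assms(1) unfolding linear_functional_iff by (metis diff_add_cancel)
  then show "dist (\<phi> y) (\<phi> x) \<le> p (y - x)"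
    using assms(3)[of "y - x"] by (simp add: dist_norm)
qed

lemma generating_seminorm_continuous:
  fixes P :: "('a::locally_convex \<Rightarrow> real) set"
  assumes sem: "\<And>p. p \<in> P \<Longrightarrow> seminorm p" and p: "p \<in> P"
    and op: "open = generate_topology {{y. p (y - x) < e} | p x e. p \<in> P \<and> e > 0}"
  shows "continuous_seminorm p"
  unfolding continuous_seminorm_def
proof (intro conjI sem p continuous_on_dist_le_seminorm[where p = p])
  show "open {y. p (y - x) < e}" if "0 < e" for x e
    unfolding op using that p by (intro generate_topology.Basis) blast
  show "dist (p y) (p x) \<le> p (y - x)" for x y
    using seminorm_diff_abs[OF sem[OF p], of y x] by (simp add: dist_real_def)
qed (rule seminorm_zero[OF sem[OF p]])

lemma continuous_seminorms_separate:
  fixes x :: "'a::locally_convex"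
  assumes "\<And>p. continuous_seminorm p \<Longrightarrow> p x = 0"
  shows "x = 0"
proof (rule ccontr)
  assume "x \<noteq> 0"
  obtain P :: "('a \<Rightarrow> real) set" where P: "\<And>p. p \<in> P \<Longrightarrow> seminorm p"
    "\<And>x. x \<noteq> 0 \<Longrightarrow> \<exists>p\<in>P. p x \<noteq> 0"
    "open = generate_topology {{y. p (y - x) < e} | p x e. p \<in> P \<and> e > 0}"
    by (rule generating_seminorms) (rule that)
  obtain p where "p \<in> P" "p x \<noteq> 0"
    using P(2)[OF \<open>x \<noteq> 0\<close>] by blast
  then show False
    using assms[OF generating_seminorm_continuous[OF P(1) _ P(3)]] by simp
qed

lemma continuous_seminorms_eqI:
  fixes x :: "'a::locally_convex"
  assumes "\<And>p. continuous_seminorm p \<Longrightarrow> p (x - y) = 0"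
  shows "x = y"
  using continuous_seminorms_separate[of "x - y"] assms by simp

text \<open>For each \<open>p\<close>, Hahn-Banach provides a functional with value
  \<open>p (x - y)\<close> at \<open>x - y\<close>. Weak identities for \<mu> become identities of
  vectors in this way.\<close>

lemma continuous_functionals_eqI:
  fixes x :: "'a::locally_convex"
  assumes "\<And>\<phi>. continuous_functional \<phi> \<Longrightarrow> \<phi> x = \<phi> y"
  shows "x = y"
proof (rule continuous_seminorms_eqI)
  fix p :: "'a \<Rightarrow> real" assume p: "continuous_seminorm p"
  obtain \<phi> where \<phi>: "Vector_Spaces.linear (*\<^sub>C) (*) \<phi>" "\<And>y. cmod (\<phi> y) \<le> p y" "\<phi> (x - y) = p (x - y)"
    using hahn_banach[OF continuous_seminormD(1)[OF p], where x = "x - y"] by blast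
  have "\<phi> (x - y) + \<phi> y = \<phi> x"
    using \<phi>(1) unfolding linear_functional_iff by (metis diff_add_cancel)
  then show "p (x - y) = 0"
    using assms[OF continuous_functional_le[OF \<phi>(1) p \<phi>(2)]] \<phi>(3) by simp
qed

lemma continuous_seminorm_tendsto:
  fixes x :: "nat \<Rightarrow> 'a::locally_convex"
  assumes "x \<longlonglongrightarrow> l" and p: "continuous_seminorm p"
  shows "(\<lambda>n. p (x n - l)) \<longlonglongrightarrow> 0"
proof (rule order_tendstoI)
  show "\<forall>\<^sub>F n in sequentially. a < p (x n - l)" if "a < 0" for a
    by (intro always_eventually allI less_le_trans[OF that] seminorm_nonneg continuous_seminormD(1) p)
  show "\<forall>\<^sub>F n in sequentially. p (x n - l) < e" if "0 < e" for e
    using topological_tendstoD[OF assms(1) open_seminorm_ball[OF p, of l e]] that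
    by (simp add: seminorm_zero[OF continuous_seminormD(1)[OF p]])
qed

section \<open>Operations on continuous seminorms and continuous operators\<close>

lemma continuous_seminorm_add:
  assumes "continuous_seminorm p" "continuous_seminorm q"
  shows "continuous_seminorm (\<lambda>x. p x + q x)"
proof -
  have "seminorm (\<lambda>x. p x + q x)"
    unfolding seminorm_def
  proof safe
    show "p (x + y) + q (x + y) \<le> p x + q x + (p y + q y)" for x y
      using assms[THEN continuous_seminormD(1), THEN seminorm_triangle, of x y] by simp
    show "p (c *\<^sub>C x) + q (c *\<^sub>C x) = cmod c * (p x + q x)" for c x
      using assms[THEN continuous_seminormD(1), THEN seminorm_scaleC, of c x] by (simp add: algebra_simps)
  qed
  then show ?thesis
    using assms by (auto simp: continuous_seminorm_def intro: continuous_on_add)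
qed

lemma continuous_seminorm_mult:
  assumes p: "continuous_seminorm p" and "0 \<le> c"
  shows "continuous_seminorm (\<lambda>x. c * p x)"
proof -
  have "seminorm (\<lambda>x. c * p x)"
    unfolding seminorm_def
    using seminormD(1,2)[OF continuous_seminormD(1)[OF p]] \<open>0 \<le> c\<close>
    by (simp add: mult_left_mono flip: distrib_left)
  then show ?thesis
    using continuous_seminormD(2)[OF p] by (auto simp: continuous_seminorm_def intro: continuous_intros)
qed

lemma continuous_operatorsD:
  assumes "T \<in> continuous_operators"
  shows "T (x + y) = T x + T y" "T (c *\<^sub>C x) = c *\<^sub>C T x" "T 0 = 0" "T (x - y) = T x - T y"
    "T (sum g I) = (\<Sum>i\<in>I. T (g i))" "continuous_on UNIV T"
proof -
  show add: "T (x + y) = T x + T y" for x y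
    using assms by (simp add: continuous_operators_def linear_scaleC_iff)
  show "T (c *\<^sub>C x) = c *\<^sub>C T x"
    using assms by (simp add: continuous_operators_def linear_scaleC_iff)
  show zero: "T 0 = 0"
    using add[of 0 0] by simp
  show "T (x - y) = T x - T y"
    using add[of "x - y" y] by simp
  show "T (sum g I) = (\<Sum>i\<in>I. T (g i))"
    by (induction I rule: infinite_finite_induct) (simp_all add: add zero)
  show "continuous_on UNIV T"
    using assms by (simp add: continuous_operators_def)
qed

lemma continuous_seminorm_operator:
  assumes T: "T \<in> continuous_operators" and p: "continuous_seminorm p"
  shows "continuous_seminorm (\<lambda>x. p (T x))"
  unfolding continuous_seminorm_def seminorm_def
proof safe
  show "p (T (x + y)) \<le> p (T x) + p (T y)" for x y
    using seminorm_triangle[OF continuous_seminormD(1)[OF p]] by (simp add: continuous_operatorsD[OF T])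
  show "p (T (c *\<^sub>C x)) = cmod c * p (T x)" for c x
    using seminorm_scaleC[OF continuous_seminormD(1)[OF p]] by (simp add: continuous_operatorsD[OF T])
  show "continuous_on UNIV (\<lambda>x. p (T x))"
    using continuous_on_compose2[OF continuous_seminormD(2)[OF p] continuous_operatorsD(6)[OF T]] by simp
qed

text \<open>It suffices to pull back subbasic balls, and \<open>p (T y - x)\<close> varies by at
  most a continuous seminorm of the increment of \<open>y\<close>.\<close>

lemma continuous_operatorsI:
  fixes T :: "'a::locally_convex \<Rightarrow> 'a"
  assumes add: "\<And>x y. T (x + y) = T x + T y" and scale: "\<And>c x. T (c *\<^sub>C x) = c *\<^sub>C T x"
    and bound: "\<And>p. continuous_seminorm p \<Longrightarrow> \<exists>q. continuous_seminorm q \<and> (\<forall>x. p (T x) \<le> q x)"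
  shows "T \<in> continuous_operators"
proof -
  obtain P :: "('a \<Rightarrow> real) set" where
    sem: "\<And>p. p \<in> P \<Longrightarrow> seminorm p" and
    "\<And>x. x \<noteq> 0 \<Longrightarrow> \<exists>p\<in>P. p x \<noteq> 0" and
    op: "open = generate_topology {{y. p (y - x) < e} | p x e. p \<in> P \<and> e > 0}"
    by (rule generating_seminorms) (rule that)
  have "continuous_on UNIV T"
  proof (rule continuous_on_generate_topology[OF op])
    fix B assume "B \<in> {{y. p (y - x) < e} | p x e. p \<in> P \<and> e > 0}"
    then obtain p x e where B: "B = {y. p (y - x) < e}" and "p \<in> P" "e > 0" by blast
    have p: "continuous_seminorm p"
      by (rule generating_seminorm_continuous[OF sem \<open>p \<in> P\<close> op])
    obtain q where q: "continuous_seminorm q" "\<And>x. p (T x) \<le> q x"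
      using bound[OF p] by blast
    have diff: "T y - T z = T (y - z)" for y z
      using add[of "y - z" z] by simp
    have "continuous_on UNIV (\<lambda>y. p (T y - x))"
    proof (rule continuous_on_dist_le[OF q(1)])
      show "dist (p (T y - x)) (p (T z - x)) \<le> q (y - z)" for y z
        using seminorm_diff_abs[OF sem[OF \<open>p \<in> P\<close>], of "T y - x" "T z - x"] q(2)[of "y - z"]
        by (simp add: dist_real_def diff)
    qed
    then have "open ((\<lambda>y. p (T y - x)) -` {..<e})"
      by (simp add: continuous_on_open_vimage)
    then show "\<exists>C. open C \<and> C \<inter> UNIV = T -` B \<inter> UNIV"
      by (intro exI[of _ "(\<lambda>y. p (T y - x)) -` {..<e}"]) (auto simp: B)
  qed
  then show ?thesis
    using add scale by (simp add: continuous_operators_def linear_scaleC_iff)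
qed

lemma continuous_operators_combination:
  assumes S: "S \<in> continuous_operators" and T: "T \<in> continuous_operators"
  shows "(\<lambda>x. a *\<^sub>C S x + b *\<^sub>C T x) \<in> continuous_operators"
proof (rule continuous_operatorsI)
  show "a *\<^sub>C S (x + y) + b *\<^sub>C T (x + y) = a *\<^sub>C S x + b *\<^sub>C T x + (a *\<^sub>C S y + b *\<^sub>C T y)" for x y
    by (simp add: continuous_operatorsD[OF S] continuous_operatorsD[OF T] scaleC_add_right)
  show "a *\<^sub>C S (c *\<^sub>C x) + b *\<^sub>C T (c *\<^sub>C x) = c *\<^sub>C (a *\<^sub>C S x + b *\<^sub>C T x)" for c x
    by (simp add: continuous_operatorsD[OF S] continuous_operatorsD[OF T] scaleC_add_right mult.commute)
  fix p :: "'a \<Rightarrow> real" assume p: "continuous_seminorm p"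
  note sp = continuous_seminormD(1)[OF p]
  show "\<exists>q. continuous_seminorm q \<and> (\<forall>x. p (a *\<^sub>C S x + b *\<^sub>C T x) \<le> q x)"
  proof (intro exI conjI allI)
    show "continuous_seminorm (\<lambda>x. cmod a * p (S x) + cmod b * p (T x))"
      using continuous_seminorm_add[OF
          continuous_seminorm_mult[OF continuous_seminorm_operator[OF S p] norm_ge_zero[of a]]
          continuous_seminorm_mult[OF continuous_seminorm_operator[OF T p] norm_ge_zero[of b]]] .
    show "p (a *\<^sub>C S x + b *\<^sub>C T x) \<le> cmod a * p (S x) + cmod b * p (T x)" for x
      using seminorm_triangle[OF sp, of "a *\<^sub>C S x" "b *\<^sub>C T x"] by (simp add: seminorm_scaleC[OF sp])
  qed
qed

lemma continuous_operators_comp: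
  assumes "S \<in> continuous_operators" "T \<in> continuous_operators"
  shows "S \<circ> T \<in> continuous_operators"
  using assms by (auto simp: continuous_operators_def linear_scaleC_iff intro: continuous_on_compose2)

section \<open>Equicontinuous spectral measures\<close>

text \<open>Pointwise form of \<open>sot_tendsto\<close>. Limits are tested on seminorms throughout,
  and topological limits occur only where sequential completeness supplies one.\<close>

definition seminorm_tendsto :: "(nat \<Rightarrow> 'a::locally_convex) \<Rightarrow> 'a \<Rightarrow> bool" where
  "seminorm_tendsto u l \<longleftrightarrow> (\<forall>p. continuous_seminorm p \<longrightarrow> (\<lambda>n. p (u n - l)) \<longlonglongrightarrow> 0)"

lemma sot_tendsto_iff: "sot_tendsto T T' \<longleftrightarrow> (\<forall>\<psi>. seminorm_tendsto (\<lambda>n. T n \<psi>) (T' \<psi>))"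
  by (auto simp: sot_tendsto_def seminorm_tendsto_def)

lemma tendsto_0_le_nonneg:
  fixes u v :: "nat \<Rightarrow> real"
  assumes "v \<longlonglongrightarrow> 0" "\<And>n. 0 \<le> u n" "\<And>n. u n \<le> v n"
  shows "u \<longlonglongrightarrow> 0"
  by (rule tendsto_sandwich[OF always_eventually always_eventually tendsto_const assms(1)])
    (use assms in auto)

lemma seminorm_tendsto_unique:
  assumes "seminorm_tendsto u l" "seminorm_tendsto u l'"
  shows "l = l'"
proof (rule continuous_seminorms_eqI)
  fix p :: "'a \<Rightarrow> real" assume p: "continuous_seminorm p"
  note sp = continuous_seminormD(1)[OF p]
  have "(\<lambda>n. p (u n - l) + p (u n - l')) \<longlonglongrightarrow> 0 + 0"
    using assms p unfolding seminorm_tendsto_def by (intro tendsto_add) blast+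
  moreover have "p (l - l') \<le> p (u n - l) + p (u n - l')" for n
    using seminorm_triangle[OF sp, of "l - u n" "u n - l'"] seminorm_minus_commute[OF sp, of l "u n"]
    by simp
  ultimately have "p (l - l') \<le> 0"
    using tendsto_lowerbound[of _ 0 sequentially "p (l - l')"] by (simp add: always_eventually)
  then show "p (l - l') = 0"
    using seminorm_nonneg[OF sp, of "l - l'"] by simp
qed

lemma seminorm_tendsto_combination:
  assumes "seminorm_tendsto u l" "seminorm_tendsto v k"
  shows "seminorm_tendsto (\<lambda>n. a *\<^sub>C u n + b *\<^sub>C v n) (a *\<^sub>C l + b *\<^sub>C k)"
  unfolding seminorm_tendsto_def
proof (intro allI impI)
  fix p :: "'a \<Rightarrow> real" assume p: "continuous_seminorm p"
  note sp = continuous_seminormD(1)[OF p]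
  have "(\<lambda>n. p (u n - l)) \<longlonglongrightarrow> 0" "(\<lambda>n. p (v n - k)) \<longlonglongrightarrow> 0"
    using assms p by (auto simp: seminorm_tendsto_def)
  then have "(\<lambda>n. cmod a * p (u n - l) + cmod b * p (v n - k)) \<longlonglongrightarrow> cmod a * 0 + cmod b * 0"
    by (intro tendsto_add tendsto_mult_left)
  moreover have "p (a *\<^sub>C u n + b *\<^sub>C v n - (a *\<^sub>C l + b *\<^sub>C k))
      \<le> cmod a * p (u n - l) + cmod b * p (v n - k)" for n
    using seminorm_triangle[OF sp, of "a *\<^sub>C (u n - l)" "b *\<^sub>C (v n - k)"]
      seminorm_scaleC[OF sp, of a "u n - l"] seminorm_scaleC[OF sp, of b "v n - k"]
    by (simp add: scaleC.scale_right_diff_distrib algebra_simps)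
  ultimately show "(\<lambda>n. p (a *\<^sub>C u n + b *\<^sub>C v n - (a *\<^sub>C l + b *\<^sub>C k))) \<longlonglongrightarrow> 0"
    by (intro tendsto_0_le_nonneg[OF _ seminorm_nonneg[OF sp]]) simp_all
qed

text \<open>The left-hand side is convex in every coefficient, so its maximum over the cube is attained
  at a vertex.\<close>

lemma seminorm_cube_bound:
  assumes p: "seminorm p" and fin: "finite I" and c: "\<And>i. i \<in> I \<Longrightarrow> 0 \<le> c i \<and> c i \<le> (1::real)"
    and B: "\<And>J. J \<subseteq> I \<Longrightarrow> p (y + sum x J) \<le> B"
  shows "p (y + (\<Sum>i\<in>I. complex_of_real (c i) *\<^sub>C x i)) \<le> B"
  using fin c B
proof (induction I arbitrary: y)
  case empty
  then show ?case using empty(2)[of "{}"] by simp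
next
  case (insert i I)
  define t where "t = complex_of_real (c i)"
  define s where "s = (\<Sum>i\<in>I. complex_of_real (c i) *\<^sub>C x i)"
  have ci: "0 \<le> c i" "c i \<le> 1" using insert.prems(1) by auto
  have "p (y + s) \<le> B"
    unfolding s_def by (rule insert.IH) (use insert.prems in blast)+
  moreover have "p (y + x i + s) \<le> B"
    unfolding s_def
  proof (rule insert.IH)
    fix J assume J: "J \<subseteq> I"
    then have "i \<notin> J" "finite J" using insert.hyps finite_subset by auto
    then show "p (y + x i + sum x J) \<le> B"
      using insert.prems(2)[of "insert i J"] J by (simp add: add.assoc subset_insertI2)
  qed (use insert.prems in blast)
  \<comment> \<open>The coordinate \<open>c i\<close> interpolates between the face without
    \<open>x i\<close> and the face with it. On the second face \<open>x i\<close> is absorbed into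
    the base point, which is why the induction leaves \<open>y\<close> arbitrary.\<close>
  moreover have "y + (t *\<^sub>C x i + s) = (1 - t) *\<^sub>C (y + s) + t *\<^sub>C (y + x i + s)"
    by (simp add: scaleC.scale_left_diff_distrib scaleC_add_right scaleC_one algebra_simps)
  then have "p (y + (t *\<^sub>C x i + s)) \<le> cmod (1 - t) * p (y + s) + cmod t * p (y + x i + s)"
    using seminorm_triangle[OF p, of "(1 - t) *\<^sub>C (y + s)" "t *\<^sub>C (y + x i + s)"]
    by (simp only: seminorm_scaleC[OF p])
  moreover have "cmod (1 - t) = 1 - c i" "cmod t = c i"
    using ci norm_of_real[of "1 - c i", where ?'a = complex] by (simp_all add: t_def)
  ultimately have "p (y + (t *\<^sub>C x i + s)) \<le> (1 - c i) * B + c i * B"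
    using ci by (smt (verit, best) mult_left_mono)
  then show ?case
    using insert.hyps by (simp add: t_def s_def algebra_simps)
qed

locale equicontinuous_spectral_measure =
  fixes M :: "'s measure" and \<mu> :: "'s set \<Rightarrow> 'a::locally_convex \<Rightarrow> 'a"
  assumes spectral: "spectral_measure M \<mu>"
    and equicontinuous: "equicontinuous_measure M \<mu>"
begin

section \<open>The algebra of the projections \<open>\<mu> A\<close>\<close>

lemma mu_operator: "A \<in> sets M \<Longrightarrow> \<mu> A \<in> continuous_operators"
  using spectral by (simp add: spectral_measure_def)

lemmas mu_linear = continuous_operatorsD[OF mu_operator]

lemma mu_space [simp]: "\<mu> (space M) x = x"
  using spectral by (simp add: spectral_measure_def)

lemma mu_Int: "A \<in> sets M \<Longrightarrow> B \<in> sets M \<Longrightarrow> \<mu> A (\<mu> B x) = \<mu> (A \<inter> B) x"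
  using spectral by (simp add: spectral_measure_def)

lemma mu_sums:
  assumes "range A \<subseteq> sets M" "disjoint_family A" "continuous_functional \<phi>"
  shows "(\<lambda>n. \<phi> (\<mu> (A n) x)) sums \<phi> (\<mu> (\<Union>n. A n) x)"
  using spectral assms unfolding spectral_measure_def by blast

lemma equicontinuousE:
  assumes "continuous_seminorm p"
  obtains q where "continuous_seminorm q" "\<And>A x. A \<in> sets M \<Longrightarrow> p (\<mu> A x) \<le> q x"
  using equicontinuous assms unfolding equicontinuous_measure_def by blast

text \<open>Additivity for the constant sequence of empty sets makes a constant series converge,
  which forces its term to be 0.\<close>

lemma mu_empty [simp]: "\<mu> {} x = 0"
proof (rule continuous_functionals_eqI)
  fix \<phi> :: "'a \<Rightarrow> complex" assume \<phi>: "continuous_functional \<phi>"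
  have "(\<lambda>n::nat. \<phi> (\<mu> {} x)) sums \<phi> (\<mu> (\<Union>n::nat. {}) x)"
    by (rule mu_sums[OF _ _ \<phi>]) (auto simp: disjoint_family_on_def)
  then have "(\<lambda>n::nat. \<phi> (\<mu> {} x)) \<longlonglongrightarrow> 0"
    by (intro summable_LIMSEQ_zero sums_summable)
  then have "\<phi> (\<mu> {} x) = 0"
    by (simp add: LIMSEQ_const_iff)
  moreover have "\<phi> (0 *\<^sub>C 0) = 0 * \<phi> 0"
    using \<phi> unfolding continuous_functional_def linear_functional_iff by blast
  ultimately show "\<phi> (\<mu> {} x) = \<phi> 0" by simp
qed

text \<open>Countable additivity is applied to \<open>A, B, {}, {}, ...\<close>, whose terms vanish
  from index 2 on by \<open>mu_empty\<close>.\<close>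

lemma mu_Un:
  assumes A: "A \<in> sets M" and B: "B \<in> sets M" and disj: "A \<inter> B = {}"
  shows "\<mu> (A \<union> B) x = \<mu> A x + \<mu> B x"
proof (rule continuous_functionals_eqI)
  fix \<phi> :: "'a \<Rightarrow> complex" assume \<phi>: "continuous_functional \<phi>"
  have lin: "\<phi> (y + z) = \<phi> y + \<phi> z" "\<phi> (c *\<^sub>C y) = c * \<phi> y" for y z c
    using \<phi> unfolding continuous_functional_def linear_functional_iff by blast+
  have "\<phi> 0 = 0" using lin(2)[of 0 0] by simp
  have "(\<lambda>n. \<phi> (\<mu> (binaryset A B n) x)) sums \<phi> (\<mu> (\<Union>n. binaryset A B n) x)"
    using A B disj by (intro mu_sums[OF _ _ \<phi>])
      (auto simp: disjoint_family_on_def binaryset_def split: if_splits)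
  moreover have "(\<lambda>n. \<phi> (\<mu> (binaryset A B n) x)) sums (\<Sum>n\<in>{0,1}. \<phi> (\<mu> (binaryset A B n) x))"
    by (rule sums_finite) (auto simp: binaryset_def \<open>\<phi> 0 = 0\<close>)
  ultimately have "\<phi> (\<mu> (A \<union> B) x) = (\<Sum>n\<in>{0,1}. \<phi> (\<mu> (binaryset A B n) x))"
    using sums_unique2 by (fastforce simp: UN_binaryset_eq)
  then show "\<phi> (\<mu> (A \<union> B) x) = \<phi> (\<mu> A x + \<mu> B x)"
    by (simp add: binaryset_def lin)
qed

lemma mu_UN:
  assumes "finite I" "\<And>i. i \<in> I \<Longrightarrow> A i \<in> sets M" "disjoint_family_on A I"
  shows "\<mu> (\<Union>i\<in>I. A i) x = (\<Sum>i\<in>I. \<mu> (A i) x)"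
  using assms
proof (induction I)
  case (insert i I)
  have "A i \<inter> (\<Union>i\<in>I. A i) = {}"
    using insert.hyps insert.prems(2) by (fastforce simp: disjoint_family_on_def)
  moreover have "(\<Union>i\<in>I. A i) \<in> sets M"
    using insert by (intro sets.finite_UN) auto
  moreover have "\<mu> (\<Union>i\<in>I. A i) x = (\<Sum>i\<in>I. \<mu> (A i) x)"
    using insert by (auto simp: disjoint_family_on_def)
  ultimately show ?case
    using insert.hyps insert.prems by (simp add: mu_Un)
qed simp

lemma mu_compl:
  assumes A: "A \<in> sets M"
  shows "\<mu> (space M - A) x = x - \<mu> A x"
proof -
  have "\<mu> (A \<union> (space M - A)) x = \<mu> A x + \<mu> (space M - A) x"
    by (rule mu_Un) (use A in auto)
  moreover have "A \<union> (space M - A) = space M"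
    using sets.sets_into_space[OF A] by blast
  ultimately show ?thesis
    by (simp add: algebra_simps)
qed

text \<open>Hahn--Banach replaces the Orlicz--Pettis theorem: by weak additivity, the limit is in the
  closure of the vectors fixed by some \<open>\<mu> (B k)\<close>, and on these the convergence is trivial.\<close>

lemma mu_incseq_tendsto:
  assumes B: "range B \<subseteq> sets M" and inc: "incseq B"
  shows "seminorm_tendsto (\<lambda>n. \<mu> (B n) x) (\<mu> (\<Union>n. B n) x)"
  unfolding seminorm_tendsto_def
proof (intro allI impI)
  fix p :: "'a \<Rightarrow> real" assume p: "continuous_seminorm p"
  note sp = continuous_seminormD(1)[OF p]
  have B': "B n \<in> sets M" for n using B by auto
  define y where "y = \<mu> (\<Union>n. B n) x"
  define N where "N = {z. \<exists>n. \<mu> (B n) z = z}"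
  have later: "\<mu> (B n) z = z" if "\<mu> (B m) z = z" "m \<le> n" for m n z
  proof -
    have "B n \<inter> B m = B m" using incseqD[OF inc that(2)] by blast
    then have "\<mu> (B n) (\<mu> (B m) z) = \<mu> (B m) z" by (simp add: mu_Int B')
    then show ?thesis using that(1) by simp
  qed
  have N_add: "z + w \<in> N" if zw: "z \<in> N" "w \<in> N" for z w
  proof -
    obtain m n where "\<mu> (B m) z = z" "\<mu> (B n) w = w" using zw by (auto simp: N_def)
    then have "\<mu> (B (max m n)) z = z" "\<mu> (B (max m n)) w = w"
      by (auto intro: later)
    then have "\<mu> (B (max m n)) (z + w) = z + w" by (simp add: mu_linear[OF B'])
    then show ?thesis unfolding N_def by blast
  qed
  have N0: "0 \<in> N" by (auto simp: N_def mu_linear[OF B'])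
  have N: "scaleC.subspace N"
  proof (rule scaleC.subspaceI[OF N0 N_add])
    show "c *\<^sub>C z \<in> N" if "z \<in> N" for c z
      using that by (auto simp: N_def mu_linear[OF B'])
  qed
  have dense: "\<exists>z\<in>N. q (y - z) < e" if q: "continuous_seminorm q" and "0 < e" for q e
  proof (rule ccontr)
    \<comment> \<open>If \<open>N\<close> stayed at distance \<open>e\<close> from \<open>y\<close>,
      some functional with value at least \<open>e\<close> at \<open>y\<close> would vanish on
      \<open>N\<close>. But the vectors \<open>\<mu> (disjointed B n) x\<close> lie in
      \<open>N\<close> and sum weakly to \<open>y\<close>.\<close>
    assume contr: "\<not> (\<exists>z\<in>N. q (y - z) < e)"
    define r where "r = (\<lambda>y. INF z\<in>N. q (y - z))"
    note quot = seminorm_quotient[OF continuous_seminormD(1)[OF q] N, folded r_def]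
    have "e \<le> r y"
      unfolding r_def using N0 contr by (intro cINF_greatest) (auto simp: not_less)
    have r_le: "r z \<le> q z" for z
      using quot(2)[OF N0, of z] by (simp add: r_def)
    obtain \<phi> where \<phi>: "Vector_Spaces.linear (*\<^sub>C) (*) \<phi>" "\<And>z. cmod (\<phi> z) \<le> r z" "\<phi> y = r y"
      using hahn_banach[OF quot(1), where x = y] by blast
    have cont: "continuous_functional \<phi>"
      by (rule continuous_functional_le[OF \<phi>(1) q order_trans[OF \<phi>(2) r_le]])
    have kill: "\<phi> z = 0" if "z \<in> N" for z
    proof -
      have "r z \<le> q (z - z)"
        using quot(2)[OF that] unfolding r_def .
      from order_trans[OF \<phi>(2) this] show ?thesis
        by (simp add: seminorm_zero[OF continuous_seminormD(1)[OF q]])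
    qed
    have dis: "disjointed B n \<in> sets M" for n
      using sets.range_disjointed_sets[OF B] by auto
    have "\<mu> (disjointed B n) x \<in> N" for n
    proof -
      have "B n \<inter> disjointed B n = disjointed B n" using disjointed_subset[of B n] by blast
      then have "\<mu> (B n) (\<mu> (disjointed B n) x) = \<mu> (disjointed B n) x"
        by (simp add: mu_Int B' dis)
      then show ?thesis unfolding N_def by blast
    qed
    moreover have "(\<lambda>n. \<phi> (\<mu> (disjointed B n) x)) sums \<phi> (\<mu> (\<Union>n. disjointed B n) x)"
      using dis by (intro mu_sums[OF _ disjoint_family_disjointed cont]) auto
    ultimately have "(\<lambda>n. 0) sums \<phi> y"
      by (simp add: kill UN_disjointed_eq y_def)
    then have "\<phi> y = 0"
      using sums_unique2[OF sums_zero] by metis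
    then show False using \<phi>(3) \<open>e \<le> r y\<close> \<open>0 < e\<close> by simp
  qed
  obtain q where q: "continuous_seminorm q" "\<And>A x. A \<in> sets M \<Longrightarrow> p (\<mu> A x) \<le> q x"
    using equicontinuousE[OF p] by blast
  have UB: "(\<Union>n. B n) \<in> sets M" using B' by blast
  have eq: "\<mu> (B n) x = \<mu> (B n) y" for n
  proof -
    have "B n \<inter> (\<Union>n. B n) = B n" by blast
    then show ?thesis by (simp add: y_def mu_Int B' UB)
  qed
  show "(\<lambda>n. p (\<mu> (B n) x - \<mu> (\<Union>n. B n) x)) \<longlonglongrightarrow> 0"
  proof (rule LIMSEQ_I)
    fix e :: real assume "0 < e"
    \<comment> \<open>Once \<open>\<mu> (B n)\<close> fixes \<open>z\<close>, only
      \<open>y - z\<close> and its image under \<open>\<mu> (B n)\<close> contribute. The summand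
      \<open>p\<close> controls the former and \<open>q\<close> the latter, uniformly in
      \<open>n\<close>.\<close>
    obtain z where z: "z \<in> N" "p (y - z) + q (y - z) < e"
      using dense[OF continuous_seminorm_add[OF p q(1)] \<open>0 < e\<close>] by blast
    obtain m where m: "\<mu> (B m) z = z" using z(1) by (auto simp: N_def)
    have "norm (p (\<mu> (B n) x - y) - 0) < e" if "m \<le> n" for n
    proof -
      have "\<mu> (B n) x - y = \<mu> (B n) (y - z) - (y - z)"
        using later[OF m that] by (simp add: eq mu_linear[OF B'])
      then have "p (\<mu> (B n) x - y) \<le> p (\<mu> (B n) (y - z)) + p (y - z)"
        by (simp only: seminorm_triangle_diff[OF sp])
      then show ?thesis
        using z(2) q(2)[OF B', of n "y - z"] seminorm_nonneg[OF sp, of "\<mu> (B n) x - y"] by simp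
    qed
    then show "\<exists>no. \<forall>n\<ge>no. norm (p (\<mu> (B n) x - \<mu> (\<Union>n. B n) x) - 0) < e"
      unfolding y_def by blast
  qed
qed

text \<open>The defining sum runs over values, which differ from one integrand to another. Here all
  functions of \<open>r\<close> are integrated over the level sets of \<open>r\<close>; with
  \<open>r\<close> a pair of simple functions, sums and products share one partition. Values in
  \<open>V\<close> that are not attained contribute \<open>\<mu> {}\<close>.\<close>

lemma simple_integral_compose:
  assumes r: "simple_function M r" and V: "finite V" "r ` space M \<subseteq> V"
  shows "simple_spectral_integral M \<mu> (\<lambda>s. F (r s)) x = (\<Sum>v\<in>V. F v *\<^sub>C \<mu> (r -` {v} \<inter> space M) x)"
proof -
  let ?R = "r ` space M"
  have fin: "finite ?R" using r by (rule simple_functionD(1))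
  have "simple_spectral_integral M \<mu> (\<lambda>s. F (r s)) x =
      (\<Sum>z\<in>F ` ?R. z *\<^sub>C \<mu> ((\<lambda>s. F (r s)) -` {z} \<inter> space M) x)"
    by (simp add: simple_spectral_integral_def image_image)
  also have "\<dots> = (\<Sum>z\<in>F ` ?R. \<Sum>v | v \<in> ?R \<and> F v = z. F v *\<^sub>C \<mu> (r -` {v} \<inter> space M) x)"
  proof (rule sum.cong[OF refl])
    fix z assume "z \<in> F ` ?R"
    have "(\<lambda>s. F (r s)) -` {z} \<inter> space M = (\<Union>v\<in>{v\<in>?R. F v = z}. r -` {v} \<inter> space M)"
      by auto
    also have "\<mu> \<dots> x = (\<Sum>v | v \<in> ?R \<and> F v = z. \<mu> (r -` {v} \<inter> space M) x)"
      using fin simple_functionD(2)[OF r] by (intro mu_UN) (auto simp: disjoint_family_on_def)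
    finally show "z *\<^sub>C \<mu> ((\<lambda>s. F (r s)) -` {z} \<inter> space M) x =
        (\<Sum>v | v \<in> ?R \<and> F v = z. F v *\<^sub>C \<mu> (r -` {v} \<inter> space M) x)"
      by (simp add: scaleC.scale_sum_right)
  qed
  also have "\<dots> = (\<Sum>v\<in>?R. F v *\<^sub>C \<mu> (r -` {v} \<inter> space M) x)"
    by (rule sum.image_gen[OF fin, symmetric])
  also have "\<dots> = (\<Sum>v\<in>V. F v *\<^sub>C \<mu> (r -` {v} \<inter> space M) x)"
  proof (rule sum.mono_neutral_left[OF V], safe)
    fix v assume "v \<notin> ?R"
    then have "r -` {v} \<inter> space M = {}" by auto
    then show "F v *\<^sub>C \<mu> (r -` {v} \<inter> space M) x = 0" by simp
  qed
  finally show ?thesis .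
qed

lemma simple_integral_operator:
  assumes "simple_function M s"
  shows "simple_spectral_integral M \<mu> s (x - y) =
    simple_spectral_integral M \<mu> s x - simple_spectral_integral M \<mu> s y"
    "simple_spectral_integral M \<mu> s (x + y) =
    simple_spectral_integral M \<mu> s x + simple_spectral_integral M \<mu> s y"
    "simple_spectral_integral M \<mu> s (c *\<^sub>C x) = c *\<^sub>C simple_spectral_integral M \<mu> s x"
  using simple_functionD(2)[OF assms]
  by (simp_all add: simple_spectral_integral_def mu_linear scaleC.scale_right_diff_distrib
      scaleC_add_right sum.distrib sum_subtractf scaleC.scale_sum_right mult.commute)

lemma simple_integral_combination:
  assumes s: "simple_function M s" and t: "simple_function M t"
  shows "simple_spectral_integral M \<mu> (\<lambda>x. a * s x + b * t x) x =
    a *\<^sub>C simple_spectral_integral M \<mu> s x + b *\<^sub>C simple_spectral_integral M \<mu> t x"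
proof -
  let ?r = "\<lambda>x. (s x, t x)"
  have r: "simple_function M ?r" using s t by simp
  note comp = simple_integral_compose[OF r simple_functionD(1)[OF r] order_refl, of _ x]
  show ?thesis
    using comp[of "\<lambda>v. a * fst v + b * snd v"] comp[of fst] comp[of snd]
    by (simp add: scaleC_add_left sum.distrib scaleC.scale_sum_right)
qed

lemma simple_integral_mult:
  assumes s: "simple_function M s" and t: "simple_function M t"
  shows "simple_spectral_integral M \<mu> (\<lambda>x. s x * t x) x =
    simple_spectral_integral M \<mu> s (simple_spectral_integral M \<mu> t x)"
proof -
  let ?r = "\<lambda>x. (s x, t x)" and ?S = "s ` space M" and ?T = "t ` space M"
  have r: "simple_function M ?r" using s t by simp
  have fin: "finite ?S" "finite ?T" using s t by (auto dest: simple_functionD(1))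
  have meas: "s -` {a} \<inter> space M \<in> sets M" "t -` {b} \<inter> space M \<in> sets M" for a b
    using s t by (auto dest: simple_functionD(2))
  have eq: "?r -` {(a, b)} \<inter> space M = (s -` {a} \<inter> space M) \<inter> (t -` {b} \<inter> space M)" for a b
    by auto
  \<comment> \<open>The full product of the two ranges is used, although some pairs may not occur,
    so that the sum factors into a double sum.\<close>
  have "simple_spectral_integral M \<mu> (\<lambda>x. fst (?r x) * snd (?r x)) x =
      (\<Sum>v\<in>?S \<times> ?T. (fst v * snd v) *\<^sub>C \<mu> (?r -` {v} \<inter> space M) x)"
    using fin by (intro simple_integral_compose[OF r]) auto
  also have "\<dots> = (\<Sum>a\<in>?S. \<Sum>b\<in>?T. (a * b) *\<^sub>C \<mu> (?r -` {(a, b)} \<inter> space M) x)"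
    by (simp add: sum.cartesian_product case_prod_unfold)
  also have "\<dots> = (\<Sum>a\<in>?S. \<Sum>b\<in>?T. a *\<^sub>C b *\<^sub>C \<mu> (s -` {a} \<inter> space M) (\<mu> (t -` {b} \<inter> space M) x))"
    by (simp only: eq mu_Int[OF meas] scaleC_scaleC)
  also have "\<dots> = simple_spectral_integral M \<mu> s (simple_spectral_integral M \<mu> t x)"
    by (simp add: simple_spectral_integral_def mu_linear[OF meas(1)] scaleC.scale_sum_right)
  finally show ?thesis by simp
qed

text \<open>Divided by \<open>K\<close>, the positive and negative parts of Re and Im of the values
  are four families of coefficients in [0,1]. Each family costs at most \<open>q\<close> by
  \<open>seminorm_cube_bound\<close>, regardless of the number of values.\<close>

lemma simple_integral_bound:
  assumes p: "seminorm p" and q: "\<And>A. A \<in> sets M \<Longrightarrow> p (\<mu> A x) \<le> q"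
    and s: "simple_function M s" and Kpos: "0 \<le> K" and K: "\<And>x. x \<in> space M \<Longrightarrow> cmod (s x) \<le> K"
  shows "p (simple_spectral_integral M \<mu> s x) \<le> 4 * K * q"
proof -
  let ?S = "s ` space M"
  define A where "A z = s -` {z} \<inter> space M" for z
  define W where "W c = (\<Sum>z\<in>?S. complex_of_real (c z) *\<^sub>C \<mu> (A z) x)" for c
  have fin: "finite ?S" using s by (rule simple_functionD(1))
  have A: "A z \<in> sets M" for z using s by (auto simp: A_def dest: simple_functionD(2))
  have W: "p (W c) \<le> q" if "\<And>z. z \<in> ?S \<Longrightarrow> 0 \<le> c z \<and> c z \<le> 1" for c
  proof -
    have "p (0 + W c) \<le> q"
      unfolding W_def
    \<comment> \<open>A vertex of the cube is a set \<open>J\<close> of values, and there the sum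
      collapses to \<mu> of a single union of level sets.\<close>
    proof (rule seminorm_cube_bound[OF p fin that])
      fix J assume "J \<subseteq> ?S"
      then have "finite J" using fin by (rule finite_subset)
      then have "(\<Sum>z\<in>J. \<mu> (A z) x) = \<mu> (\<Union>z\<in>J. A z) x"
        using A by (intro mu_UN[symmetric]) (auto simp: disjoint_family_on_def A_def)
      then show "p (0 + (\<Sum>z\<in>J. \<mu> (A z) x)) \<le> q"
        using q[OF sets.finite_UN[OF \<open>finite J\<close> A]] by simp
    qed auto
    then show ?thesis by simp
  qed
  show ?thesis
  \<comment> \<open>The normalisation divides by \<open>K\<close>; for \<open>K = 0\<close> all
    values of \<open>s\<close> are 0.\<close>
  proof (cases "K = 0")
    case True
    then have "simple_spectral_integral M \<mu> s x = 0"
      using K by (auto simp: simple_spectral_integral_def intro!: sum.neutral)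
    then show ?thesis using True by (simp add: seminorm_zero[OF p])
  next
    case K0: False
    let ?a = "\<lambda>z. max 0 (Re z) / K" and ?b = "\<lambda>z. max 0 (- Re z) / K"
    let ?c = "\<lambda>z. max 0 (Im z) / K" and ?d = "\<lambda>z. max 0 (- Im z) / K"
    have Re_Im: "\<bar>Re z\<bar> \<le> K" "\<bar>Im z\<bar> \<le> K" if "z \<in> ?S" for z
      using that K abs_Re_le_cmod[of z] abs_Im_le_cmod[of z] by fastforce+
    have bounds: "p (W ?a) \<le> q" "p (W ?b) \<le> q" "p (W ?c) \<le> q" "p (W ?d) \<le> q"
      using Kpos K0 by (intro W; use Re_Im in \<open>force simp: field_simps\<close>)+
    define k where "k = complex_of_real K"
    have k: "k \<noteq> 0" "cmod k = K" "cmod (- k) = K" "cmod (\<i> * k) = K" "cmod (- \<i> * k) = K"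
      using K0 Kpos by (simp_all add: k_def norm_mult)
    have dec: "z = k * ?a z + (- k) * ?b z + (\<i> * k) * ?c z + (- \<i> * k) * ?d z" for z
      using K0 by (simp add: complex_eq_iff k_def max_def)
    have "(\<Sum>z\<in>?S. z *\<^sub>C \<mu> (A z) x) = k *\<^sub>C W ?a + (- k) *\<^sub>C W ?b + (\<i> * k) *\<^sub>C W ?c + (- \<i> * k) *\<^sub>C W ?d"
      unfolding W_def scaleC.scale_sum_right sum.distrib[symmetric] scaleC_scaleC scaleC_add_left[symmetric]
      by (simp only: dec[symmetric])
    then have "p (simple_spectral_integral M \<mu> s x) =
        p (k *\<^sub>C W ?a + (- k) *\<^sub>C W ?b + (\<i> * k) *\<^sub>C W ?c + (- \<i> * k) *\<^sub>C W ?d)"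
      by (simp only: simple_spectral_integral_def A_def)
    also have "\<dots> \<le> p (k *\<^sub>C W ?a) + p ((- k) *\<^sub>C W ?b) + p ((\<i> * k) *\<^sub>C W ?c) + p ((- \<i> * k) *\<^sub>C W ?d)"
      by (intro order_trans[OF seminorm_triangle[OF p]] add_mono order_refl)
    also have "\<dots> \<le> K * q + K * q + K * q + K * q"
      unfolding seminorm_scaleC[OF p] k using Kpos bounds by (intro add_mono mult_left_mono)
    finally show ?thesis by simp
  qed
qed

lemma simple_integral_indicator:
  assumes A: "A \<in> sets M"
  shows "simple_spectral_integral M \<mu> (indicator A) x = \<mu> A x"
proof -
  have "simple_function M (\<lambda>s. s \<in> A)"
    using A sets.Int_space_eq2[OF A]
    by (auto simp: simple_function_def vimage_def Int_def conj_commute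
        intro!: sets.sets_Collect finite_subset[OF subset_UNIV])
  from simple_integral_compose[OF this finite_class.finite_UNIV subset_UNIV, of of_bool x]
  have "simple_spectral_integral M \<mu> (\<lambda>s. of_bool (s \<in> A)) x = \<mu> ((\<lambda>s. s \<in> A) -` {True} \<inter> space M) x"
    by (simp add: UNIV_bool scaleC_one)
  moreover have "(\<lambda>s. s \<in> A) -` {True} \<inter> space M = A"
    using sets.sets_into_space[OF A] by auto
  ultimately show ?thesis
    by (simp add: indicator_def[abs_def] of_bool_def)
qed

end

section \<open>The bounded functional calculus\<close>

text \<open>Real and imaginary parts are rounded down to a grid of mesh \<open>1 / Suc n\<close>.
  The error is at most the mesh in each part, uniformly in the point, and boundedness leaves only
  finitely many grid values.\<close>

lemma bounded_complex_measurable_uniform_approx: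
  fixes g :: "'s \<Rightarrow> complex"
  assumes g: "g \<in> borel_measurable M" and bdd: "bounded (g ` space M)"
  obtains s where "\<And>n. simple_function M (s n)" "uniform_limit (space M) s g sequentially"
proof
  define r where "r n x = real_of_int \<lfloor>x * real (Suc n)\<rfloor> / real (Suc n)" for n :: nat and x :: real
  define s where "s n x = Complex (r n (Re (g x))) (r n (Im (g x)))" for n x
  have r_approx: "\<bar>r n x - x\<bar> \<le> inverse (real (Suc n))" for n x
  proof -
    have "r n x - x = (real_of_int \<lfloor>x * real (Suc n)\<rfloor> - x * real (Suc n)) / real (Suc n)"
      by (simp add: r_def field_simps)
    moreover have "\<bar>real_of_int \<lfloor>x * real (Suc n)\<rfloor> - x * real (Suc n)\<bar> \<le> 1"
      by linarith
    ultimately show ?thesis by (simp add: inverse_eq_divide divide_right_mono)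
  qed
  obtain K where K: "\<And>x. x \<in> space M \<Longrightarrow> cmod (g x) \<le> K"
    using bdd by (auto simp: bounded_iff)
  show "simple_function M (s n)" for n
  proof (rule simple_function_borel_measurable)
    have "r n \<in> borel_measurable borel" unfolding r_def by measurable
    then show "s n \<in> borel_measurable M"
      using g unfolding s_def Complex_eq by measurable
    define Z where "Z = (\<lambda>k. real_of_int k / real (Suc n)) ` {\<lfloor>- K * real (Suc n)\<rfloor>..\<lfloor>K * real (Suc n)\<rfloor>}"
    have Z: "r n x \<in> Z" if "\<bar>x\<bar> \<le> K" for x
    proof -
      have "- K * real (Suc n) \<le> x * real (Suc n)" "x * real (Suc n) \<le> K * real (Suc n)"
        using that by (intro mult_right_mono; simp)+
      then show ?thesis
        unfolding Z_def r_def by (intro imageI) (simp add: floor_mono del: of_nat_Suc)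
    qed
    have "s n ` space M \<subseteq> (\<lambda>(a, b). Complex a b) ` (Z \<times> Z)"
    proof
      fix z assume "z \<in> s n ` space M"
      then obtain x where x: "x \<in> space M" "z = s n x" by blast
      have "\<bar>Re (g x)\<bar> \<le> K" "\<bar>Im (g x)\<bar> \<le> K"
        using K[OF x(1)] abs_Re_le_cmod[of "g x"] abs_Im_le_cmod[of "g x"] by linarith+
      then show "z \<in> (\<lambda>(a, b). Complex a b) ` (Z \<times> Z)"
        using Z by (force simp: x(2) s_def)
    qed
    then show "finite (s n ` space M)"
      by (rule finite_subset) (simp add: Z_def)
  qed
  show "uniform_limit (space M) s g sequentially"
  proof (rule uniform_limitI)
    fix e :: real assume "0 < e"
    then obtain N where N: "inverse (real (Suc N)) < e / 2"
      using reals_Archimedean[of "e / 2"] by auto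
    have "dist (s n x) (g x) < e" if "N \<le> n" for n x
    proof -
      have "cmod (s n x - g x) \<le> \<bar>Re (s n x - g x)\<bar> + \<bar>Im (s n x - g x)\<bar>"
        by (rule cmod_le)
      also have "\<dots> \<le> inverse (real (Suc n)) + inverse (real (Suc n))"
        using r_approx by (intro add_mono) (simp_all add: s_def)
      also have "inverse (real (Suc n)) \<le> inverse (real (Suc N))"
        using that by (intro le_imp_inverse_le) auto
      finally show ?thesis using N by (simp add: dist_norm)
    qed
    then show "\<forall>\<^sub>F n in sequentially. \<forall>x\<in>space M. dist (s n x) (g x) < e"
      by (auto simp: eventually_sequentially)
  qed
qed

context equicontinuous_spectral_measure
begin

section \<open>Size, linearity and uniqueness of the integral\<close>

lemma has_integralE:
  assumes "has_spectral_integral M \<mu> g T"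
  obtains s where "\<And>n. simple_function M (s n)" "uniform_limit (space M) s g sequentially"
    "\<And>x. seminorm_tendsto (\<lambda>n. simple_spectral_integral M \<mu> (s n) x) (T x)"
  using assms by (auto simp: has_spectral_integral_def sot_tendsto_iff)

lemma integral_operator: "has_spectral_integral M \<mu> g T \<Longrightarrow> T \<in> continuous_operators"
  by (simp add: has_spectral_integral_def)

text \<open>The simple bound survives the limit because the approximants exceed \<open>K\<close> by
  an arbitrarily small amount. Only the size of the integrand enters, so one estimate serves every
  power of a function of modulus at most 1.\<close>

lemma integral_bound:
  assumes T: "has_spectral_integral M \<mu> g T"
    and p: "continuous_seminorm p" and q: "\<And>A. A \<in> sets M \<Longrightarrow> p (\<mu> A x) \<le> q"
    and K: "0 \<le> K" "\<And>s. s \<in> space M \<Longrightarrow> cmod (g s) \<le> K"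
  shows "p (T x) \<le> 4 * K * q"
proof (rule field_le_epsilon)
  fix e :: real assume "0 < e"
  note sp = continuous_seminormD(1)[OF p]
  obtain s where s: "\<And>n. simple_function M (s n)" "uniform_limit (space M) s g sequentially"
    "\<And>x. seminorm_tendsto (\<lambda>n. simple_spectral_integral M \<mu> (s n) x) (T x)"
    using has_integralE[OF T] by blast
  have "0 \<le> q" using q[of "{}"] by (simp add: seminorm_zero[OF sp])
  \<comment> \<open>Chosen to make the excess \<open>4 * d * q\<close> at most \<open>e / 2\<close>;
    the \<open>+ 1\<close> covers \<open>q = 0\<close>.\<close>
  define d where "d = e / (2 * (4 * (q + 1)))"
  have "0 < d" using \<open>0 < e\<close> \<open>0 \<le> q\<close> by (simp add: d_def)
  have "4 * d * q \<le> e / 2"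
  proof -
    have "4 * d * q \<le> 4 * d * (q + 1)" using \<open>0 < d\<close> by simp
    also have "\<dots> = e / 2" using \<open>0 \<le> q\<close> by (simp add: d_def field_simps)
    finally show ?thesis .
  qed
  have "\<forall>\<^sub>F n in sequentially. \<forall>x\<in>space M. dist (s n x) (g x) < d"
    by (rule uniform_limitD[OF s(2) \<open>0 < d\<close>])
  moreover have "\<forall>\<^sub>F n in sequentially. p (simple_spectral_integral M \<mu> (s n) x - T x) < e / 2"
    using s(3) p \<open>0 < e\<close> unfolding seminorm_tendsto_def by (intro order_tendstoD(2)) auto
  ultimately have "\<forall>\<^sub>F n in sequentially. p (T x) \<le> 4 * K * q + e"
  proof eventually_elim
    case (elim n)
    have "cmod (s n x) \<le> K + d" if "x \<in> space M" for x
      using elim(1) K(2)[OF that] that norm_triangle_ineq[of "s n x - g x" "g x"]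
      by (fastforce simp: dist_norm)
    then have "p (simple_spectral_integral M \<mu> (s n) x) \<le> 4 * (K + d) * q"
      using K(1) \<open>0 < d\<close> by (intro simple_integral_bound sp q s) auto
    moreover have "p (T x) \<le> p (simple_spectral_integral M \<mu> (s n) x) +
        p (simple_spectral_integral M \<mu> (s n) x - T x)"
      using seminorm_triangle_diff[OF sp, of "simple_spectral_integral M \<mu> (s n) x"
          "simple_spectral_integral M \<mu> (s n) x - T x"] by simp
    ultimately show ?case
      using elim(2) \<open>4 * d * q \<le> e / 2\<close> by (simp add: algebra_simps)
  qed
  then show "p (T x) \<le> 4 * K * q + e"
    by (auto simp: eventually_sequentially)
qed

lemma integral_cong:
  assumes "has_spectral_integral M \<mu> g T" "\<And>s. s \<in> space M \<Longrightarrow> g s = h s"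
  shows "has_spectral_integral M \<mu> h T"
proof -
  have "uniform_limit (space M) s g sequentially \<longleftrightarrow> uniform_limit (space M) s h sequentially" for s
    by (rule uniform_limit_cong') (simp_all add: assms(2))
  then show ?thesis
    using assms(1) by (simp add: has_spectral_integral_def)
qed

lemma integral_combination:
  assumes T: "has_spectral_integral M \<mu> g T" and S: "has_spectral_integral M \<mu> h S"
  shows "has_spectral_integral M \<mu> (\<lambda>s. a * g s + b * h s) (\<lambda>x. a *\<^sub>C T x + b *\<^sub>C S x)"
proof -
  obtain s where s: "\<And>n. simple_function M (s n)" "uniform_limit (space M) s g sequentially"
    "\<And>x. seminorm_tendsto (\<lambda>n. simple_spectral_integral M \<mu> (s n) x) (T x)"
    using has_integralE[OF T] by blast
  obtain t where t: "\<And>n. simple_function M (t n)" "uniform_limit (space M) t h sequentially"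
    "\<And>x. seminorm_tendsto (\<lambda>n. simple_spectral_integral M \<mu> (t n) x) (S x)"
    using has_integralE[OF S] by blast
  have ul: "uniform_limit (space M) (\<lambda>n x. c * u n x) (\<lambda>x. c * k x) sequentially"
    if "uniform_limit (space M) u k sequentially" for c :: complex and u k
    by (rule bounded_linear.uniform_limit[OF bounded_linear_mult_right that])
  show ?thesis
    unfolding has_spectral_integral_def sot_tendsto_iff
  proof (intro conjI exI[of _ "\<lambda>n x. a * s n x + b * t n x"] allI)
    show "(\<lambda>x. a *\<^sub>C T x + b *\<^sub>C S x) \<in> continuous_operators"
      by (rule continuous_operators_combination[OF integral_operator[OF T] integral_operator[OF S]])
    show "simple_function M (\<lambda>x. a * s n x + b * t n x)" for n
      using simple_function_compose2[OF s(1) t(1), of "\<lambda>x y. a * x + b * y"] .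
    show "uniform_limit (space M) (\<lambda>n x. a * s n x + b * t n x) (\<lambda>x. a * g x + b * h x) sequentially"
      by (intro uniform_limit_add ul s t)
    show "seminorm_tendsto (\<lambda>n. simple_spectral_integral M \<mu> (\<lambda>x. a * s n x + b * t n x) x)
        (a *\<^sub>C T x + b *\<^sub>C S x)" for x
      using seminorm_tendsto_combination[OF s(3) t(3)] by (simp add: simple_integral_combination s t)
  qed
qed

lemma integral_diff:
  assumes "has_spectral_integral M \<mu> g T" "has_spectral_integral M \<mu> h S"
  shows "has_spectral_integral M \<mu> (\<lambda>s. g s - h s) (\<lambda>x. T x - S x)"
  using integral_combination[OF assms, of 1 "-1"] by (simp add: scaleC_one)

lemma integral_scale:
  assumes "has_spectral_integral M \<mu> g T"
  shows "has_spectral_integral M \<mu> (\<lambda>s. c * g s) (\<lambda>x. c *\<^sub>C T x)"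
  using integral_combination[OF assms assms, of c 0] by simp

text \<open>The difference has integrand 0, so the bound applies with \<open>K = 0\<close>: the
  approximating sequence is irrelevant.\<close>

lemma integral_unique:
  assumes "has_spectral_integral M \<mu> g T" "has_spectral_integral M \<mu> g S"
  shows "T = S"
proof
  fix x
  show "T x = S x"
  proof (rule continuous_seminorms_eqI)
    fix p :: "'a \<Rightarrow> real" assume p: "continuous_seminorm p"
    obtain q where q: "continuous_seminorm q" "\<And>A x. A \<in> sets M \<Longrightarrow> p (\<mu> A x) \<le> q x"
      using equicontinuousE[OF p] by blast
    have "p (T x - S x) \<le> 4 * 0 * q x"
      by (rule integral_bound[OF integral_diff[OF assms] p q(2)]) auto
    then show "p (T x - S x) = 0"
      using seminorm_nonneg[OF continuous_seminormD(1)[OF p], of "T x - S x"] by simp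
  qed
qed

lemma spectral_integral_eq:
  "has_spectral_integral M \<mu> g T \<Longrightarrow> spectral_integral M \<mu> g = T"
  unfolding spectral_integral_def by (blast intro: integral_unique)

lemma integral_indicator:
  assumes A: "A \<in> sets M"
  shows "has_spectral_integral M \<mu> (indicator A) (\<mu> A)"
  unfolding has_spectral_integral_def sot_tendsto_def
proof (intro conjI exI[of _ "\<lambda>n. indicator A"] allI impI mu_operator A simple_function_indicator)
  show "uniform_limit (space M) (\<lambda>n. indicator A) (indicator A) sequentially"
    by (rule uniform_limit_const)
  show "(\<lambda>n. p (simple_spectral_integral M \<mu> (indicator A) \<psi> - \<mu> A \<psi>)) \<longlonglongrightarrow> 0"
    if "continuous_seminorm p" for p \<psi>
    using that by (simp add: simple_integral_indicator A seminorm_zero continuous_seminormD)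
qed

lemma integral_one: "has_spectral_integral M \<mu> (\<lambda>s. 1) id"
proof -
  have "\<mu> (space M) = id" by auto
  then show ?thesis
    using integral_cong[OF integral_indicator[OF sets.top], of "\<lambda>s. 1"] by simp
qed

text \<open>Both factors vary with \<open>n\<close>, so the error is split: the simple integral of
  \<open>s n\<close> applied to the error of \<open>t n\<close> at \<open>x\<close>, controlled by a
  bound uniform in \<open>n\<close>, plus the error of \<open>s n\<close> at the fixed vector
  \<open>S x\<close>.\<close>

lemma integral_mult:
  assumes T: "has_spectral_integral M \<mu> g T" and S: "has_spectral_integral M \<mu> h S"
    and g: "bounded (g ` space M)" and h: "bounded (h ` space M)"
  shows "has_spectral_integral M \<mu> (\<lambda>s. g s * h s) (\<lambda>x. T (S x))"
proof -
  obtain s where s: "\<And>n. simple_function M (s n)" "uniform_limit (space M) s g sequentially"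
    "\<And>x. seminorm_tendsto (\<lambda>n. simple_spectral_integral M \<mu> (s n) x) (T x)"
    using has_integralE[OF T] by blast
  obtain t where t: "\<And>n. simple_function M (t n)" "uniform_limit (space M) t h sequentially"
    "\<And>x. seminorm_tendsto (\<lambda>n. simple_spectral_integral M \<mu> (t n) x) (S x)"
    using has_integralE[OF S] by blast
  obtain K where K: "\<And>x. x \<in> space M \<Longrightarrow> cmod (g x) \<le> K"
    using g by (auto simp: bounded_iff)
  \<comment> \<open>Eventually \<open>s n\<close> is within 1 of \<open>g\<close>. The
    \<open>max\<close> keeps \<open>L\<close> nonnegative even when \<open>space M\<close> is empty
    and \<open>K\<close> is arbitrary.\<close>
  define L where "L = max 0 K + 1"
  let ?I = "\<lambda>s. simple_spectral_integral M \<mu> s"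
  show ?thesis
    unfolding has_spectral_integral_def sot_tendsto_def
  proof (intro conjI exI[of _ "\<lambda>n x. s n x * t n x"] allI impI)
    show "(\<lambda>x. T (S x)) \<in> continuous_operators"
      using continuous_operators_comp[OF integral_operator[OF T] integral_operator[OF S]]
      by (simp add: comp_def)
    show "simple_function M (\<lambda>x. s n x * t n x)" for n
      using simple_function_compose2[OF s(1) t(1), of "\<lambda>x y. x * y"] .
    show "uniform_limit (space M) (\<lambda>n x. s n x * t n x) (\<lambda>x. g x * h x) sequentially"
      by (rule uniform_lim_mult[OF s(2) t(2) g h])
    fix p :: "'a \<Rightarrow> real" and x
    assume p: "continuous_seminorm p"
    note sp = continuous_seminormD(1)[OF p]
    obtain q where q: "continuous_seminorm q" "\<And>A x. A \<in> sets M \<Longrightarrow> p (\<mu> A x) \<le> q x"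
      using equicontinuousE[OF p] by blast
    have "(\<lambda>n. p (?I (s n) (S x) - T (S x))) \<longlonglongrightarrow> 0" "(\<lambda>n. q (?I (t n) x - S x)) \<longlonglongrightarrow> 0"
      using s(3) t(3) p q(1) unfolding seminorm_tendsto_def by blast+
    then have "(\<lambda>n. 4 * L * q (?I (t n) x - S x) + p (?I (s n) (S x) - T (S x))) \<longlonglongrightarrow> 4 * L * 0 + 0"
      by (intro tendsto_add tendsto_mult_left)
    then have lim: "(\<lambda>n. 4 * L * q (?I (t n) x - S x) + p (?I (s n) (S x) - T (S x))) \<longlonglongrightarrow> 0"
      by simp
    have "\<forall>\<^sub>F n in sequentially. \<forall>x\<in>space M. dist (s n x) (g x) < 1"
      by (rule uniform_limitD[OF s(2) zero_less_one])
    then have bound: "\<forall>\<^sub>F n in sequentially. p (?I (\<lambda>x. s n x * t n x) x - T (S x)) \<le>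
        4 * L * q (?I (t n) x - S x) + p (?I (s n) (S x) - T (S x))"
    proof eventually_elim
      case (elim n)
      have "cmod (s n y) \<le> L" if "y \<in> space M" for y
        using elim K[OF that] that norm_triangle_ineq[of "s n y - g y" "g y"]
        by (fastforce simp: dist_norm L_def)
      then have "p (?I (s n) (?I (t n) x - S x)) \<le> 4 * L * q (?I (t n) x - S x)"
        by (intro simple_integral_bound sp q s) (auto simp: L_def)
      moreover have "?I (\<lambda>x. s n x * t n x) x - T (S x) =
          ?I (s n) (?I (t n) x - S x) + (?I (s n) (S x) - T (S x))"
        by (simp add: simple_integral_mult simple_integral_operator s t)
      then have "p (?I (\<lambda>x. s n x * t n x) x - T (S x)) \<le>
          p (?I (s n) (?I (t n) x - S x)) + p (?I (s n) (S x) - T (S x))"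
        by (simp only: seminorm_triangle[OF sp])
      ultimately show ?case by linarith
    qed
    show "(\<lambda>n. p (?I (\<lambda>x. s n x * t n x) x - T (S x))) \<longlonglongrightarrow> 0"
      by (rule tendsto_sandwich[OF _ bound tendsto_const lim])
        (simp add: seminorm_nonneg[OF sp])
  qed
qed

lemma integral_power:
  assumes T: "has_spectral_integral M \<mu> g T" and g: "bounded (g ` space M)"
  shows "has_spectral_integral M \<mu> (\<lambda>s. g s ^ n) (T ^^ n)"
proof (induction n)
  case 0
  then show ?case using integral_one by (simp add: id_def)
next
  case (Suc n)
  obtain K where K: "\<And>x. x \<in> space M \<Longrightarrow> cmod (g x) \<le> K"
    using g by (auto simp: bounded_iff)
  have "bounded ((\<lambda>s. g s ^ n) ` space M)"
    unfolding bounded_iff using K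
    by (intro exI[of _ "K ^ n"]) (auto simp: norm_power intro!: power_mono)
  from integral_mult[OF T Suc g this] show ?case
    by (simp add: comp_def)
qed

lemma integral_exists:
  assumes complete: "sequentially_complete TYPE('a)"
    and g: "g \<in> borel_measurable M" and bdd: "bounded (g ` space M)"
  obtains T where "has_spectral_integral M \<mu> g T"
proof -
  obtain s where s: "\<And>n. simple_function M (s n)" "uniform_limit (space M) s g sequentially"
    using bounded_complex_measurable_uniform_approx[OF g bdd] by blast
  let ?I = "\<lambda>n x. simple_spectral_integral M \<mu> (s n) x"
  have "\<exists>l. (\<lambda>n. ?I n x) \<longlonglongrightarrow> l" for x
  proof (rule complete[unfolded sequentially_complete_def, rule_format])
    fix p :: "'a \<Rightarrow> real" and e :: real assume p: "continuous_seminorm p" and "0 < e"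
    note sp = continuous_seminormD(1)[OF p]
    obtain q where q: "continuous_seminorm q" "\<And>A x. A \<in> sets M \<Longrightarrow> p (\<mu> A x) \<le> q x"
      using equicontinuousE[OF p] by blast
    have "0 \<le> q x" using seminorm_nonneg continuous_seminormD(1) q(1) by blast
    \<comment> \<open>Two approximants within \<open>d\<close> of \<open>g\<close> differ by less
      than \<open>2 * d\<close>, so their integrals differ by at most \<open>8 * d * q x\<close>,
      which this choice keeps below \<open>e\<close>.\<close>
    define d where "d = e / (16 * (q x + 1))"
    have "0 < d" using \<open>0 < e\<close> \<open>0 \<le> q x\<close> by (simp add: d_def)
    have d: "4 * (2 * d) * q x < e"
    proof -
      have "4 * (2 * d) * q x \<le> 8 * d * (q x + 1)" using \<open>0 < d\<close> by simp
      also have "\<dots> = e / 2" using \<open>0 \<le> q x\<close> by (simp add: d_def field_simps)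
      finally show ?thesis using \<open>0 < e\<close> by simp
    qed
    obtain N where N: "\<And>n y. N \<le> n \<Longrightarrow> y \<in> space M \<Longrightarrow> dist (s n y) (g y) < d"
      using uniform_limitD[OF s(2) \<open>0 < d\<close>] by (auto simp: eventually_sequentially)
    have "p (?I m x - ?I n x) < e" if "N \<le> m" "N \<le> n" for m n
    proof -
      have sf: "simple_function M (\<lambda>y. 1 * s m y + (-1) * s n y)"
        using simple_function_compose2[OF s(1) s(1), of "\<lambda>x y. 1 * x + (-1) * y"] .
      have "cmod (1 * s m y + (-1) * s n y) \<le> 2 * d" if "y \<in> space M" for y
        using N[OF \<open>N \<le> m\<close> that] N[OF \<open>N \<le> n\<close> that] dist_triangle2[of "s m y" "s n y" "g y"]
        by (simp add: dist_norm)
      then have "p (simple_spectral_integral M \<mu> (\<lambda>y. 1 * s m y + (-1) * s n y) x) \<le> 4 * (2 * d) * q x"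
        using \<open>0 < d\<close> by (intro simple_integral_bound sp q sf) auto
      moreover have "simple_spectral_integral M \<mu> (\<lambda>y. 1 * s m y + (-1) * s n y) x = ?I m x - ?I n x"
        by (subst simple_integral_combination[OF s(1) s(1)]) (simp add: scaleC_one)
      ultimately show ?thesis using d by simp
    qed
    then show "\<exists>N. \<forall>m\<ge>N. \<forall>n\<ge>N. p (?I m x - ?I n x) < e" by blast
  qed
  then obtain T where lim: "\<And>x. (\<lambda>n. ?I n x) \<longlonglongrightarrow> T x" by metis
  then have T: "seminorm_tendsto (\<lambda>n. ?I n x) (T x)" for x
    unfolding seminorm_tendsto_def using continuous_seminorm_tendsto[OF lim] by simp
  obtain K where K: "0 \<le> K" "\<And>x. x \<in> space M \<Longrightarrow> cmod (g x) \<le> K"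
    using bdd by (metis bounded_pos imageI less_imp_le)
  \<comment> \<open>A pointwise limit of continuous operators need not be continuous. Here the
    simple integrals eventually share a seminorm bound, as \<open>s n\<close> is bounded by
    \<open>K + 1\<close>, and the bound passes to \<open>T\<close>.\<close>
  have "T \<in> continuous_operators"
  proof (rule continuous_operatorsI)
    show "T (x + y) = T x + T y" for x y
      using seminorm_tendsto_combination[OF T[of x] T[of y], of 1 1]
      by (intro seminorm_tendsto_unique[OF T]) (simp add: simple_integral_operator s scaleC_one)
    show "T (c *\<^sub>C x) = c *\<^sub>C T x" for c x
      using seminorm_tendsto_combination[OF T[of x] T[of x], of c 0]
      by (intro seminorm_tendsto_unique[OF T]) (simp add: simple_integral_operator s)
    fix p :: "'a \<Rightarrow> real" assume p: "continuous_seminorm p"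
    note sp = continuous_seminormD(1)[OF p]
    obtain q where q: "continuous_seminorm q" "\<And>A x. A \<in> sets M \<Longrightarrow> p (\<mu> A x) \<le> q x"
      using equicontinuousE[OF p] by blast
    have "\<forall>\<^sub>F n in sequentially. \<forall>x\<in>space M. dist (s n x) (g x) < 1"
      by (rule uniform_limitD[OF s(2) zero_less_one])
    then have bound: "\<forall>\<^sub>F n in sequentially. p (T x) \<le> 4 * (K + 1) * q x + p (?I n x - T x)" for x
    proof eventually_elim
      case (elim n)
      have "cmod (s n y) \<le> K + 1" if "y \<in> space M" for y
        using elim K(2)[OF that] that norm_triangle_ineq[of "s n y - g y" "g y"]
        by (fastforce simp: dist_norm)
      then have "p (?I n x) \<le> 4 * (K + 1) * q x"
        using K(1) by (intro simple_integral_bound sp q s) auto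
      then show ?case
        using seminorm_triangle_diff[OF sp, of "?I n x" "?I n x - T x"] by simp
    qed
    have "p (T x) \<le> 4 * (K + 1) * q x + 0" for x
      using T[of x] p unfolding seminorm_tendsto_def
      by (intro tendsto_lowerbound[OF tendsto_add[OF tendsto_const] bound]) auto
    moreover have "continuous_seminorm (\<lambda>x. 4 * (K + 1) * q x)"
      using K(1) by (intro continuous_seminorm_mult q) simp
    ultimately show "\<exists>q. continuous_seminorm q \<and> (\<forall>x. p (T x) \<le> q x)"
      by (intro exI[of _ "\<lambda>x. 4 * (K + 1) * q x"]) simp
  qed
  then show ?thesis
    using that s T unfolding has_spectral_integral_def sot_tendsto_iff by blast
qed

text \<open>The change of variables is exact for simple functions, and uniform approximation on the
  plane pulls back along \<open>f\<close>. In the final theorem this converts an integral against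
  \<open>E\<close> into one against \<mu>.\<close>

lemma integral_image_measure:
  assumes f: "f \<in> borel_measurable M"
    and T: "has_spectral_integral borel (\<lambda>B. \<mu> (f -` B \<inter> space M)) g T"
  shows "has_spectral_integral M \<mu> (\<lambda>s. g (f s)) T"
proof -
  obtain t where t: "\<And>n. simple_function borel (t n)" "uniform_limit UNIV t g sequentially"
    "sot_tendsto (\<lambda>n. simple_spectral_integral borel (\<lambda>B. \<mu> (f -` B \<inter> space M)) (t n)) T"
    using T by (auto simp: has_spectral_integral_def)
  have r: "simple_function M (\<lambda>s. t n (f s))" for n
    by (rule simple_function_borel_measurable)
      (use f t(1)[of n] in \<open>auto intro: measurable_compose borel_measurable_simple_function
        finite_subset[OF _ simple_functionD(1)[OF t(1)[of n]]]\<close>)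
  have "simple_spectral_integral borel (\<lambda>B. \<mu> (f -` B \<inter> space M)) (t n) x =
      simple_spectral_integral M \<mu> (\<lambda>s. t n (f s)) x" for n x
  proof -
    have "simple_spectral_integral M \<mu> (\<lambda>s. t n (f s)) x =
        (\<Sum>v\<in>range (t n). v *\<^sub>C \<mu> ((\<lambda>s. t n (f s)) -` {v} \<inter> space M) x)"
      using simple_functionD(1)[OF t(1)[of n]]
      by (intro simple_integral_compose[OF r, where F = "\<lambda>v. v"]) auto
    then show ?thesis
      by (simp add: simple_spectral_integral_def vimage_def)
  qed
  then have "sot_tendsto (\<lambda>n. simple_spectral_integral M \<mu> (\<lambda>s. t n (f s))) T"
    using t(3) by (simp add: sot_tendsto_def)
  moreover have "uniform_limit (space M) (\<lambda>n s. t n (f s)) (\<lambda>s. g (f s)) sequentially"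
    using t(2) unfolding uniform_limit_iff by (auto elim!: eventually_mono)
  ultimately show ?thesis
    using T r unfolding has_spectral_integral_def
    by (intro conjI exI[of _ "\<lambda>n s. t n (f s)"]) simp_all
qed

end

section \<open>The mean ergodic theorem for spectral integrals\<close>

lemma averaging_diff:
  assumes "\<And>k. T ^^ k \<in> continuous_operators"
  shows "averaging n T (x - y) = averaging n T x - averaging n T y"
  by (simp add: averaging_def continuous_operatorsD(4)[OF assms] sum_subtractf
      scaleC.scale_right_diff_distrib)

text \<open>At \<open>n = 0\<close> the average is 0 because \<open>inverse 0 = 0\<close>, hence the
  positivity condition.\<close>

lemma averaging_fixed:
  assumes "T x = x" "0 < n"
  shows "averaging n T x = x"
proof -
  have "(T ^^ k) x = x" for k
    by (induction k) (simp_all add: assms(1))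
  moreover have "(\<Sum>k<n. x) = of_nat n *\<^sub>C x"
    by (induction n) (simp_all add: scaleC_add_left scaleC_one)
  ultimately show ?thesis
    using assms(2) by (simp add: averaging_def scaleC_one)
qed

text \<open>The orbit sum telescopes and only its ends survive, so bounded orbits make these
  averages decay like \<open>1 / n\<close>.\<close>

lemma averaging_coboundary:
  assumes "\<And>k. T ^^ k \<in> continuous_operators"
  shows "averaging n T (x - T x) = inverse (of_nat n) *\<^sub>C (x - (T ^^ n) x)"
proof -
  have "(\<Sum>k<n. (T ^^ k) (x - T x)) = (\<Sum>k<n. (T ^^ k) x - (T ^^ Suc k) x)"
    by (simp add: continuous_operatorsD(4)[OF assms] funpow_swap1)
  also have "\<dots> = x - (T ^^ n) x"
    by (subst sum_lessThan_telescope') simp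
  finally show ?thesis by (simp add: averaging_def)
qed

lemma averaging_bound:
  assumes p: "seminorm p" and B: "\<And>k. p ((T ^^ k) x) \<le> B" and n: "0 < n"
  shows "p (averaging n T x) \<le> B"
proof -
  have "p (averaging n T x) = inverse (real n) * p (\<Sum>k<n. (T ^^ k) x)"
    by (simp add: averaging_def seminorm_scaleC[OF p] norm_inverse)
  also have "\<dots> \<le> inverse (real n) * (\<Sum>k<n. B)"
    by (intro mult_left_mono order_trans[OF seminorm_sum[OF p]] sum_mono B) simp
  finally show ?thesis using n by (simp add: field_simps)
qed

context equicontinuous_spectral_measure
begin

theorem mean_ergodic:
  assumes complete: "sequentially_complete TYPE('a)"
    and T: "has_spectral_integral M \<mu> h T"
    and h: "h \<in> borel_measurable M" "\<And>s. s \<in> space M \<Longrightarrow> cmod (h s) \<le> 1"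
  shows "sot_tendsto (\<lambda>n. averaging n T) (\<mu> {s \<in> space M. h s = 1})"
  unfolding sot_tendsto_def
proof (intro allI impI)
  fix p :: "'a \<Rightarrow> real" and x
  assume p: "continuous_seminorm p"
  note sp = continuous_seminormD(1)[OF p]
  obtain q where q: "continuous_seminorm q" "\<And>A x. A \<in> sets M \<Longrightarrow> p (\<mu> A x) \<le> q x"
    using equicontinuousE[OF p] by blast
  have h_bdd: "bounded (h ` space M)"
    using h(2) by (auto simp: bounded_iff)
  note pow = integral_power[OF T h_bdd]
  note pow_op = integral_operator[OF pow]
  \<comment> \<open>The constant does not grow with \<open>k\<close>: the integral bound is applied
    to \<open>h ^ k\<close> directly, with \<open>K = 1\<close>.\<close>
  have pow_bound: "p ((T ^^ k) y) \<le> 4 * q y" for k y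
    using integral_bound[OF pow p q(2), of 1 k] h(2) by (simp add: norm_power power_le_one)
  have ind_bdd: "bounded (indicator A ` space M :: complex set)" for A
    by (rule boundedI[where B = 1]) (auto simp: indicator_def)
  define F where "F = {s \<in> space M. h s = 1}"
  have F: "F \<in> sets M" using h(1) unfolding F_def by measurable
  define B where "B k = {s \<in> space M. inverse (real (Suc k)) \<le> cmod (1 - h s)}" for k
  have B: "B k \<in> sets M" for k using h(1) unfolding B_def by measurable
  have "incseq B"
  proof (rule incseq_SucI)
    show "B k \<le> B (Suc k)" for k
    proof -
      have "inverse (real (Suc (Suc k))) \<le> inverse (real (Suc k))"
        by (rule le_imp_inverse_le) auto
      then show ?thesis unfolding B_def by (blast intro: order_trans)
    qed
  qed
  have UN_B: "(\<Union>k. B k) = space M - F"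
  proof (intro set_eqI iffI)
    fix s assume "s \<in> (\<Union>k. B k)"
    then obtain k where "s \<in> space M" "inverse (real (Suc k)) \<le> cmod (1 - h s)"
      by (auto simp: B_def)
    moreover have "0 < inverse (real (Suc k))" by simp
    ultimately show "s \<in> space M - F" by (auto simp: F_def simp del: of_nat_Suc)
  next
    fix s assume s: "s \<in> space M - F"
    then have "0 < cmod (1 - h s)" by (auto simp: F_def)
    from reals_Archimedean[OF this] obtain k where "inverse (real (Suc k)) < cmod (1 - h s)"
      by blast
    then show "s \<in> (\<Union>k. B k)" using s by (auto simp: B_def intro: less_imp_le)
  qed
  have fixed: "T (\<mu> F x) = \<mu> F x"
  proof -
    have "has_spectral_integral M \<mu> (indicator F) (\<lambda>x. T (\<mu> F x))"
      by (rule integral_cong[OF integral_mult[OF T integral_indicator[OF F] h_bdd ind_bdd]])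
        (auto simp: F_def indicator_def)
    from integral_unique[OF this integral_indicator[OF F]] show ?thesis by metis
  qed
  have range: "\<exists>g. \<mu> (B k) x = g - T g" for k
  proof -
    \<comment> \<open>On \<open>B k\<close> the function \<open>1 - h\<close> has an inverse bounded
      by \<open>Suc k\<close>. Its integral \<open>G\<close> exists by completeness, and
      \<open>G x\<close> is the required preimage of \<open>\<mu> (B k) x\<close> under
      \<open>I - T\<close>.\<close>
    define u where "u s = (if s \<in> B k then inverse (1 - h s) else 0)" for s
    have "u \<in> borel_measurable M"
      unfolding u_def using B h(1) by measurable
    moreover have "cmod (u s) \<le> real (Suc k)" for s
    proof (cases "s \<in> B k")
      case True
      then have "inverse (cmod (1 - h s)) \<le> inverse (inverse (real (Suc k)))"
        by (intro le_imp_inverse_le) (auto simp: B_def simp del: of_nat_Suc)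
      then show ?thesis using True by (simp add: u_def norm_inverse)
    qed (simp add: u_def)
    then have u_bdd: "bounded (u ` space M)" by (intro boundedI) auto
    ultimately obtain G where G: "has_spectral_integral M \<mu> u G"
      using integral_exists[OF complete] by blast
    have "cmod (1 - h s) \<le> 2" if "s \<in> space M" for s
      using h(2)[OF that] norm_triangle_ineq4[of 1 "h s"] by simp
    then have "bounded ((\<lambda>s. 1 - h s) ` space M)" by (intro boundedI) auto
    from integral_mult[OF integral_diff[OF integral_one T] G this u_bdd]
    have "has_spectral_integral M \<mu> (indicator (B k)) (\<lambda>x. id (G x) - T (G x))"
    proof (rule integral_cong)
      fix s
      have "1 - h s \<noteq> 0" if "s \<in> B k"
      proof
        assume "1 - h s = 0"
        then have "inverse (real (Suc k)) \<le> 0" using that by (simp add: B_def del: of_nat_Suc)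
        then show False by simp
      qed
      then show "(1 - h s) * u s = indicator (B k) s"
        by (auto simp: u_def indicator_def)
    qed
    from integral_unique[OF integral_indicator[OF B] this] show ?thesis
      by auto
  qed
  \<comment> \<open>Every average with \<open>n > 0\<close> reproduces \<open>\<mu> F x\<close>, so
    what remains is that the averages of the complementary part tend to 0.\<close>
  define y where "y = x - \<mu> F x"
  have reduce: "averaging n T x - \<mu> F x = averaging n T y" if "0 < n" for n
    using averaging_fixed[of T, OF fixed that] by (simp add: y_def averaging_diff[OF pow_op])
  have "(\<lambda>n. p (averaging n T x - \<mu> F x)) \<longlonglongrightarrow> 0"
  proof (rule LIMSEQ_I)
    fix e :: real assume "0 < e"
    have "seminorm_tendsto (\<lambda>k. \<mu> (B k) x) y"
      using mu_incseq_tendsto[OF _ \<open>incseq B\<close>, of x] B by (auto simp: UN_B mu_compl[OF F] y_def)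
    then have "(\<lambda>k. q (\<mu> (B k) x - y)) \<longlonglongrightarrow> 0"
      using q(1) by (simp add: seminorm_tendsto_def)
    \<comment> \<open>Averaging costs the factor 4 of \<open>pow_bound\<close>, so
      \<open>e / 8\<close> uses up \<open>e / 2\<close>; the other half is left for the
      coboundary.\<close>
    then have "\<forall>\<^sub>F k in sequentially. q (\<mu> (B k) x - y) < e / 8"
      by (rule order_tendstoD(2)) (use \<open>0 < e\<close> in simp)
    then obtain k where "q (\<mu> (B k) x - y) < e / 8"
      by (auto simp: eventually_sequentially)
    then have k: "q (y - \<mu> (B k) x) < e / 8"
      by (simp add: seminorm_minus_commute[OF continuous_seminormD(1)[OF q(1)]])
    obtain g where g: "\<mu> (B k) x = g - T g" using range by blast
    \<comment> \<open>An upper bound for \<open>p (g - (T ^^ n) g)\<close> valid for all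
      \<open>n\<close>; \<open>g\<close> depends on \<open>k\<close>, which is fixed before
      \<open>N\<close> is chosen.\<close>
    define c where "c = p g + 4 * q g"
    obtain N where N: "c / (e / 2) < real N" using reals_Archimedean2 by blast
    have "norm (p (averaging n T x - \<mu> F x) - 0) < e" if "Suc N \<le> n" for n
    proof -
      have n: "0 < n" "real N < real n" using that by auto
      have "p (averaging n T (y - \<mu> (B k) x)) \<le> 4 * q (y - \<mu> (B k) x)"
        by (rule averaging_bound[OF sp pow_bound n(1)])
      moreover have "p (averaging n T (\<mu> (B k) x)) < e / 2"
      proof -
        have "p (averaging n T (\<mu> (B k) x)) = inverse (real n) * p (g - (T ^^ n) g)"
          by (simp add: g averaging_coboundary[OF pow_op] seminorm_scaleC[OF sp] norm_inverse)
        also have "\<dots> \<le> inverse (real n) * c"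
          using order_trans[OF seminorm_triangle_diff[OF sp, of g "(T ^^ n) g"]
              add_left_mono[OF pow_bound[of n g]]]
          by (intro mult_left_mono) (simp_all add: c_def)
        also have "\<dots> < e / 2"
        proof -
          have "c / (e / 2) < real n" using N n(2) by (rule less_trans)
          then show ?thesis using n(1) \<open>0 < e\<close> by (simp add: field_simps)
        qed
        finally show ?thesis .
      qed
      moreover have "p (averaging n T y) \<le> p (averaging n T (y - \<mu> (B k) x)) + p (averaging n T (\<mu> (B k) x))"
        using seminorm_triangle[OF sp, of "averaging n T (y - \<mu> (B k) x)" "averaging n T (\<mu> (B k) x)"]
        by (simp add: averaging_diff[OF pow_op])
      ultimately show ?thesis
        using k reduce[OF n(1)] seminorm_nonneg[OF sp, of "averaging n T y"] by simp
    qed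
    then show "\<exists>no. \<forall>n\<ge>no. norm (p (averaging n T x - \<mu> F x) - 0) < e" by blast
  qed
  then show "(\<lambda>n. p (averaging n T x - \<mu> {s \<in> space M. h s = 1} x)) \<longlonglongrightarrow> 0"
    by (simp add: F_def)
qed

end

theorem proposition3p8:
  fixes M :: "'s measure"
    and \<mu> :: "'s set \<Rightarrow> 'f::locally_convex \<Rightarrow> 'f"
    and f :: "'s \<Rightarrow> complex"
    and E :: "complex set \<Rightarrow> 'f \<Rightarrow> 'f"
    and U :: "'f \<Rightarrow> 'f"
    and C :: real
    and lam :: complex
  assumes separable: "separable_space (euclidean :: 'f topology)"
    and seq_complete: "sequentially_complete TYPE('f)"
    and weakly_compact: "locally_seq_weakly_compact TYPE('f)"
    and spectral: "spectral_measure M \<mu>"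
    and equicontinuous: "equicontinuous_measure M \<mu>"
    and f_measurable: "f \<in> borel_measurable M"
    and f_bounded: "bounded (f ` space M)"
    and E_eq: "E = (\<lambda>B. \<mu> (f -` B \<inter> space M))"
    and U_eq: "U = spectral_integral M \<mu> f"
    and U_spectrum: "has_spectral_set_integral borel E (spectrum U) (\<lambda>z. z) U"
    and minimal: "minimal_point_spectrum U"
    and circles: "concentrated_on_isolated_circles M f U"
    and C_pos: "0 < inverse C"
    and C_le: "inverse C \<le> (INF \<xi>\<in>spectrum U. cmod \<xi>)"
    and lam: "lam \<in> point_spectrum U"
  shows "sot_tendsto
           (\<lambda>n. averaging n (\<lambda>\<psi>. lam *\<^sub>C inv U (\<psi> - E {\<xi> \<in> spectrum U. cmod \<xi> < cmod lam} \<psi>)))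
           (E {lam})"
proof -
  interpret equicontinuous_spectral_measure M \<mu>
    using spectral equicontinuous by unfold_locales
  let ?\<sigma> = "spectrum U"
  \<comment> \<open>\<open>spectral_integral\<close> is a definite description, so existence has to
    come before \<open>U_eq\<close> can be used.\<close>
  obtain U' where "has_spectral_integral M \<mu> f U'"
    using integral_exists[OF seq_complete f_measurable f_bounded] by blast
  then have U: "has_spectral_integral M \<mu> f U"
    using spectral_integral_eq U_eq by metis
  note U_lin = continuous_operatorsD[OF integral_operator[OF U]]
  have \<sigma>: "?\<sigma> \<in> sets borel"
    and U\<sigma>: "has_spectral_integral M \<mu> (\<lambda>s. if f s \<in> ?\<sigma> then f s else 0) U"
    using U_spectrum integral_image_measure[OF f_measurable]
    unfolding has_spectral_set_integral_def E_eq by blast+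
  have ind_bdd: "bounded (indicator A ` space M :: complex set)" for A
    by (rule boundedI[where B = 1]) (auto simp: indicator_def)
  have away: "inverse C \<le> cmod \<xi>" if "\<xi> \<in> ?\<sigma>" for \<xi>
    using C_le cINF_lower[OF _ that, of cmod] by (fastforce intro: bdd_belowI2[where m = 0])
  have "lam \<in> ?\<sigma>" using lam by (simp add: point_spectrum_def)
  have "0 \<notin> ?\<sigma>" using away[of 0] C_pos by auto
  have "lam \<noteq> 0" using \<open>lam \<in> ?\<sigma>\<close> \<open>0 \<notin> ?\<sigma>\<close> by auto
  \<comment> \<open>Since 0 lies in the resolvent set, \<open>pencil U 0\<close>, which is
    \<open>- U\<close>, is injective.\<close>
  have kernel: "x = 0" if "U x = 0" for x
  proof -
    have "inj (pencil U 0)"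
      using \<open>0 \<notin> ?\<sigma>\<close> by (simp add: spectrum_def resolvent_set_def)
    moreover have "pencil U 0 x = pencil U 0 0"
      using that by (simp add: pencil_def U_lin)
    ultimately show ?thesis by (auto dest: injD)
  qed

  define D where "D = f -` (- ?\<sigma>) \<inter> space M"
  have D: "D \<in> sets M"
    unfolding D_def using \<sigma> by (intro measurable_sets[OF f_measurable]) auto
  have D_null: "\<mu> D x = 0" for x
  proof (rule kernel)
    \<comment> \<open>The integrand is \<open>f\<close> restricted to \<open>D\<close>, written as
      the difference of two functions that both integrate to \<open>U\<close>.\<close>
    have "has_spectral_integral M \<mu> (\<lambda>s. f s - (if f s \<in> ?\<sigma> then f s else 0)) (\<lambda>x. U (\<mu> D x))"
      by (rule integral_cong[OF integral_mult[OF U integral_indicator[OF D] f_bounded ind_bdd]])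
        (auto simp: D_def indicator_def)
    from integral_unique[OF this integral_diff[OF U U\<sigma>]] show "U (\<mu> D x) = 0"
      by (simp add: fun_eq_iff)
  qed
  have D_compl: "\<mu> (space M - D) x = x" for x
    by (simp add: mu_compl[OF D] D_null)

  \<comment> \<open>The value 0 off the spectrum keeps \<open>v\<close> bounded by \<open>C\<close>.
    The products with \<open>f\<close> are then the indicator of the complement of \<open>D\<close>,
    whose integral is the identity because \<open>\<mu> D\<close> vanishes.\<close>
  define v where "v s = (if f s \<in> ?\<sigma> then inverse (f s) else 0)" for s
  have v_meas: "v \<in> borel_measurable M"
    unfolding v_def using f_measurable \<sigma> by measurable
  have "cmod (v s) \<le> C" for s
    using le_imp_inverse_le[OF away C_pos, of "f s"] C_pos by (auto simp: v_def norm_inverse)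
  then have v_bdd: "bounded (v ` space M)" by (intro boundedI) auto
  obtain V where V: "has_spectral_integral M \<mu> v V"
    using integral_exists[OF seq_complete v_meas v_bdd] by blast
  have fv: "f s * v s = indicator (space M - D) s" "v s * f s = indicator (space M - D) s"
    if "s \<in> space M" for s
    using that \<open>0 \<notin> ?\<sigma>\<close> by (cases "f s = 0"; auto simp: v_def D_def indicator_def)+
  have ID: "has_spectral_integral M \<mu> (indicator (space M - D)) (\<mu> (space M - D))"
    using D by (intro integral_indicator) auto
  have "(\<lambda>x. U (V x)) = \<mu> (space M - D)"
    using integral_unique[OF integral_cong[OF integral_mult[OF U V f_bounded v_bdd] fv(1)] ID] .
  moreover have "(\<lambda>x. V (U x)) = \<mu> (space M - D)"
    using integral_unique[OF integral_cong[OF integral_mult[OF V U v_bdd f_bounded] fv(2)] ID] .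
  \<comment> \<open>The resolvent condition alone yields an inverse on a dense range; the two-sided
    inverse \<open>V\<close> makes \<open>U\<close> bijective, so \<open>inv U\<close> is a genuine
    inverse everywhere.\<close>
  ultimately have inv_U: "inv U = V"
    by (intro inv_equality) (metis D_compl)+

  define \<Omega> where "\<Omega> = f -` {\<xi> \<in> ?\<sigma>. cmod \<xi> < cmod lam} \<inter> space M"
  have "{\<xi>. cmod \<xi> < cmod lam} \<in> sets borel" by measurable
  then have \<Omega>: "\<Omega> \<in> sets M"
    unfolding \<Omega>_def using sets.Int[OF \<sigma>] by (intro measurable_sets[OF f_measurable]) (simp add: Collect_conj_eq)
  \<comment> \<open>\<open>h\<close> equals \<open>lam / f\<close> where \<open>f\<close> lies in
    the spectrum with modulus at least \<open>|lam|\<close>, and 0 elsewhere on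
    \<open>space M\<close>. Cutting out \<Omega> removes exactly the points of the spectrum at which
    the quotient exceeds 1 in modulus.\<close>
  define h where "h s = lam * (v s * indicator (space M - \<Omega>) s)" for s
  define T where "T x = lam *\<^sub>C inv U (x - E {\<xi> \<in> ?\<sigma>. cmod \<xi> < cmod lam} x)" for x
  have "T = (\<lambda>x. lam *\<^sub>C V (\<mu> (space M - \<Omega>) x))"
    by (simp only: T_def inv_U E_eq mu_compl[OF \<Omega>] \<Omega>_def[symmetric] fun_eq_iff simp_thms)
  then have T: "has_spectral_integral M \<mu> h T"
    unfolding h_def
    using integral_scale[OF integral_mult[OF V integral_indicator v_bdd ind_bdd]] sets.compl_sets[OF \<Omega>]
    by blast
  have "h \<in> borel_measurable M"
    unfolding h_def using v_meas \<Omega> by measurable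
  moreover have "cmod (h s) \<le> 1" if "s \<in> space M" for s
    using that \<open>0 \<notin> ?\<sigma>\<close>
    by (cases "f s = 0";
        auto simp: h_def v_def \<Omega>_def indicator_def norm_mult norm_divide not_less field_simps)
  ultimately have "sot_tendsto (\<lambda>n. averaging n T) (\<mu> {s \<in> space M. h s = 1})"
    by (rule mean_ergodic[OF seq_complete T])
  \<comment> \<open>The value 1 rules out the region where \<open>h\<close> was set to 0, leaving
    \<open>lam / f s = 1\<close>; conversely \<open>lam\<close> itself lies in the spectrum and
    outside the removed disc.\<close>
  moreover have "{s \<in> space M. h s = 1} = f -` {lam} \<inter> space M"
    using \<open>0 \<notin> ?\<sigma>\<close> \<open>lam \<in> ?\<sigma>\<close> \<open>lam \<noteq> 0\<close>
    by (auto simp: h_def v_def \<Omega>_def indicator_def field_simps split: if_splits)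
  ultimately show ?thesis
    by (simp add: T_def[abs_def] E_eq)
qed

end
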